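(* Let $e:X\to Y$ be a compactification of a completely regular space $X$ and let $s:X\to\beta X$ be the Stone–Čech compactification of $X$. Then the following conditions are equivalent. (1) The de Vries extension $e^{-1}:\mathcal{RO}(Y)\to\wp(X)$ is maximal. (2) $e$ is isomorphic to $s$ in the category $\mathsf{Comp}$. (3) $e$ is equivalent to $s$.
   Context: **Compactifications.** Completely regular spaces are taken to be Hausdorff. A compactification of a completely regular space $X$ is a topological embedding $e:X\to Y$ with $Y$ compact Hausdorff and $e(X)$ dense in $Y$. For compactifications $e:X\to Y$, $e':X\to Y'$ of the same space, $e\le e'$ means there is a continuous $f:Y'\to Y$ with $f\circ e'=e$; $e$ and $e'$ are equivalent if $e\le e'$ and $e'\le e$ (equivalently, there is a homeomorphism $f:Y'\to Y$ with $f\circ e'=e$). The Stone–Čech compactification is the largest one up to equivalence. The category $\mathsf{Comp}$ has as objects compactifications $e:X\to Y$ ($X$ varying); a morphism from $e:X\to Y$ to $e':X'\to Y'$ is a pair $(f,g)$ of continuous maps $f:X\to X'$, $g:Y\to Y'$ with $g\circ e=e'\circ f$; composition is componentwise. **De Vries algebras.** A de Vries proximity on a Boolean algebra $A$ is a binary relation $\prec$ such that: (DV1) $1\prec 1$; (DV2) $a\prec b$ implies $a\le b$; (DV3) $a\le b\prec c\le d$ implies $a\prec d$; (DV4) $a\prec b$ and $a\prec c$ imply $a\prec b\wedge c$; (DV5) $a\prec b$ implies $\neg b\prec\neg a$; (DV6) $a\prec b$ implies there is $c$ with $a\prec c\prec b$; (DV7) $b\neq 0$ implies there is $a\neq 0$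 with $a\prec b$. A de Vries algebra is a pair $\mathfrak{A}=(A,\prec)$ with $A$ a complete Boolean algebra and $\prec$ a de Vries proximity on $A$. It is extremally disconnected if $\prec$ is $\le$, and atomic if $A$ is an atomic Boolean algebra. A map $\rho:\mathfrak{A}\to\mathfrak{B}$ between de Vries algebras is a de Vries morphism if (M1) $\rho(0)=0$; (M2) $\rho(a\wedge b)=\rho(a)\wedge\rho(b)$; (M3) $a\prec b$ implies $\neg\rho(\neg a)\prec\rho(b)$; (M4) $\rho(b)=\bigvee\{\rho(a)\mid a\prec b\}$. The composition of de Vries morphisms is $(\rho_2\star\rho_1)(b)=\bigvee\{\rho_2\rho_1(a)\mid a\prec b\}$. **De Vries extensions.** A de Vries extension is a one-to-one de Vries morphism $\alpha:\mathfrak{A}\to\mathfrak{B}$, with $\mathfrak{A}$ a de Vries algebra and $\mathfrak{B}=(B,\le)$ an atomic extremally disconnected de Vries algebra, such that each element of $\mathfrak{B}$ is a join of meets of elements of $\alpha[\mathfrak{A}]$. Two de Vries extensions $\alpha:\mathfrak{A}\to\mathfrak{B}$ and $\gamma:\mathfrak{C}\to\mathfrak{B}$ are compatible if $\alpha[\mathfrak{A}]=\gamma[\mathfrak{C}]$. A de Vries extension $\alpha:\mathfrak{A}\to\mathfrak{B}$ is maximal if for every compatible de Vries extension $\gamma:\mathfrak{C}\to\mathfrak{B}$ there is a de Vries morphism $\delta:\mathfrak{C}\to\mathfrak{A}$ with $\alpha\star\delta=\gamma$. **The extension of a compactification.** $\mathcal{RO}(Y)$ is the complete Boolean algebra of regular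 open subsets of $Y$ with proximity $U\prec V$ iff $\operatorname{cl}(U)\subseteq V$, and $\wp(X)$ denotes the atomic extremally disconnected de Vries algebra $(\wp(X),\subseteq)$. For every compactification $e:X\to Y$ the map $e^{-1}:\mathcal{RO}(Y)\to\wp(X)$ is a de Vries extension. *)

theory Defs
  imports "HOL-Analysis.Analysis" "HOL-Algebra.Complete_Lattice"
begin

(* otherwise closure_of is ambiguous *)
no_notation eq_closure_of (\<open>closure'_of\<index>\<close>)

section \<open>Compactifications\<close>

definition compactification :: "'x topology \<Rightarrow> 'y topology \<Rightarrow> ('x \<Rightarrow> 'y) \<Rightarrow> bool" where
  "compactification X Y e \<longleftrightarrow>
     completely_regular_space X \<and> Hausdorff_space X \<and>
     compact_space Y \<and> Hausdorff_space Y \<and>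
     embedding_map X Y e \<and> Y closure_of (e ` topspace X) = topspace Y"

definition compactification_le ::
    "'x topology \<Rightarrow> 'y topology \<Rightarrow> ('x \<Rightarrow> 'y) \<Rightarrow> 'z topology \<Rightarrow> ('x \<Rightarrow> 'z) \<Rightarrow> bool" where
  "compactification_le X Y e Y' e' \<longleftrightarrow>
     (\<exists>f. continuous_map Y' Y f \<and> (\<forall>x \<in> topspace X. f (e' x) = e x))"

definition compactification_equiv ::
    "'x topology \<Rightarrow> 'y topology \<Rightarrow> ('x \<Rightarrow> 'y) \<Rightarrow> 'z topology \<Rightarrow> ('x \<Rightarrow> 'z) \<Rightarrow> bool" where
  "compactification_equiv X Y e Y' e' \<longleftrightarrow>
     compactification_le X Y e Y' e' \<and> compactification_le X Y' e' Y e"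

text \<open>
  The largest compactification. A definition cannot quantify over types, so the compactifications
  compared with \<open>s\<close> are those whose points are sets of subsets of \<open>X\<close>. Every compactification
  of \<open>X\<close> is homeomorphic over \<open>X\<close> to one of these, so \<open>s\<close> is above all compactifications of \<open>X\<close>,
  in any type: see \<open>stone_cech_largest\<close> below.
\<close>

definition stone_cech :: "'x topology \<Rightarrow> 'z topology \<Rightarrow> ('x \<Rightarrow> 'z) \<Rightarrow> bool" where
  "stone_cech X Z s \<longleftrightarrow>
     compactification X Z s \<and>
     (\<forall>(Y :: 'x set set topology) e. compactification X Y e \<longrightarrow> compactification_le X Y e Z s)"

lemma embedding_map_image:
  assumes "embedding_map X Y e"
  shows "e ` topspace X \<subseteq> topspace Y"
proof -
  have "e ` topspace X = topspace (subtopology Y (e ` topspace X))"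
    using assms unfolding embedding_map_def by (rule homeomorphic_imp_surjective_map)
  then show ?thesis
    unfolding topspace_subtopology by blast
qed

lemma compactification_copy:
  fixes X :: "'x topology" and Y :: "'y topology"
  assumes "compactification X Y e"
  obtains Y' :: "'x set set topology" and h where
    "homeomorphic_map Y Y' h" "compactification X Y' (h \<circ> e)"
proof -
  define h where "h y = {{x \<in> topspace X. e x \<in> U} | U. openin Y U \<and> y \<in> U}" for y
  have dense: "Y closure_of (e ` topspace X) = topspace Y" and haus: "Hausdorff_space Y"
    and emb: "embedding_map X Y e"
    using assms by (auto simp: compactification_def)
  have inj: "inj_on h (topspace Y)"
  proof (rule inj_onI, rule ccontr)
    fix y z assume y: "y \<in> topspace Y" and z: "z \<in> topspace Y" and eq: "h y = h z" and "y \<noteq> z"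
    then obtain U V where UV: "openin Y U" "openin Y V" "y \<in> U" "z \<in> V" "disjnt U V"
      using haus unfolding Hausdorff_space_def by metis
    have "{x \<in> topspace X. e x \<in> U} \<in> h y"
      unfolding h_def using UV(1,3) by blast
    then have "{x \<in> topspace X. e x \<in> U} \<in> h z"
      by (simp only: eq)
    then obtain W where W: "openin Y W" "z \<in> W"
        "{x \<in> topspace X. e x \<in> U} = {x \<in> topspace X. e x \<in> W}"
      by (auto simp: h_def)
    have "openin Y (W \<inter> V)" "W \<inter> V \<noteq> {}" using W UV by auto
    then have "e ` topspace X \<inter> (W \<inter> V) \<noteq> {}"
      using dense dense_intersects_open by metis
    then obtain x where "x \<in> topspace X" "e x \<in> W \<inter> V" by auto
    with W UV show False unfolding disjnt_def by blast
  qed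
  define k where "k = inv_into (topspace Y) h"
  define Y' where "Y' = pullback_topology (h ` topspace Y) k Y"
  have kh: "k (h y) = y" if "y \<in> topspace Y" for y
    using that inj by (simp add: k_def)
  have hom: "homeomorphic_maps Y Y' h k"
    unfolding homeomorphic_maps_def
  proof (intro conjI ballI)
    have "continuous_map Y Y (k \<circ> h)"
      by (rule continuous_map_eq[OF continuous_map_id]) (auto simp: kh)
    then show "continuous_map Y Y' h"
      unfolding Y'_def by (intro continuous_map_pullback') auto
    show "continuous_map Y' Y k"
      using continuous_map_pullback[OF continuous_map_id, of "h ` topspace Y" k Y]
      by (simp add: Y'_def)
  qed (auto simp: kh Y'_def topspace_pullback_topology)
  then have h: "homeomorphic_map Y Y' h"
    by (auto simp: homeomorphic_map_maps)
  have sp: "Y homeomorphic_space Y'"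
    using hom by (auto simp: homeomorphic_space_def)
  have sub: "e ` topspace X \<subseteq> topspace Y"
    by (rule embedding_map_image[OF emb])
  have "embedding_map X Y' (h \<circ> e)"
    by (rule embedding_map_compose[OF emb])
      (simp add: h homeomorphic_imp_surjective_map[OF h] embedding_map_def)
  moreover have "Y' closure_of ((h \<circ> e) ` topspace X) = topspace Y'"
    using homeomorphic_map_closure_of[OF h sub] homeomorphic_imp_surjective_map[OF h] dense
    by (simp add: image_comp)
  ultimately have "compactification X Y' (h \<circ> e)"
    using assms homeomorphic_compact_space[OF sp] homeomorphic_Hausdorff_space[OF sp]
    by (auto simp: compactification_def)
  with h that show thesis by blast
qed

lemma stone_cech_largest:
  fixes X :: "'x topology" and Y :: "'y topology" and Z :: "'z topology"
  assumes s: "stone_cech X Z s" and e: "compactification X Y e"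
  shows "compactification_le X Y e Z s"
proof -
  obtain Y' :: "'x set set topology" and h where
    h: "homeomorphic_map Y Y' h" and Y': "compactification X Y' (h \<circ> e)"
    using compactification_copy[OF e] by blast
  obtain k where k: "homeomorphic_maps Y Y' h k"
    using h homeomorphic_map_maps by blast
  obtain f where f: "continuous_map Z Y' f" "\<And>x. x \<in> topspace X \<Longrightarrow> f (s x) = h (e x)"
    using s Y' unfolding stone_cech_def compactification_le_def comp_apply by blast
  have "e ` topspace X \<subseteq> topspace Y"
    using e by (simp add: compactification_def embedding_map_image)
  then have "\<forall>x \<in> topspace X. (k \<circ> f) (s x) = e x"
    using f k by (auto simp: homeomorphic_maps_def)
  moreover have "continuous_map Z Y (k \<circ> f)"
    using f k continuous_map_compose by (auto simp: homeomorphic_maps_def)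
  ultimately show ?thesis
    unfolding compactification_le_def by blast
qed

subsection \<open>The category of compactifications\<close>

definition comp_morphism ::
    "'x topology \<Rightarrow> 'y topology \<Rightarrow> ('x \<Rightarrow> 'y) \<Rightarrow> 'u topology \<Rightarrow> 'v topology \<Rightarrow> ('u \<Rightarrow> 'v) \<Rightarrow>
     ('x \<Rightarrow> 'u) \<times> ('y \<Rightarrow> 'v) \<Rightarrow> bool" where
  "comp_morphism X Y e X' Y' e' = (\<lambda>(f, g).
     continuous_map X X' f \<and> continuous_map Y Y' g \<and> (\<forall>x \<in> topspace X. g (e x) = e' (f x)))"

definition comp_compose ::
    "('u \<Rightarrow> 'p) \<times> ('v \<Rightarrow> 'q) \<Rightarrow> ('x \<Rightarrow> 'u) \<times> ('y \<Rightarrow> 'v) \<Rightarrow> ('x \<Rightarrow> 'p) \<times> ('y \<Rightarrow> 'q)" where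
  "comp_compose = (\<lambda>(f', g') (f, g). (f' \<circ> f, g' \<circ> g))"

text \<open>Maps between spaces are total functions, so morphisms are compared on the points only.\<close>

definition comp_is_identity ::
    "'x topology \<Rightarrow> 'y topology \<Rightarrow> ('x \<Rightarrow> 'x) \<times> ('y \<Rightarrow> 'y) \<Rightarrow> bool" where
  "comp_is_identity X Y = (\<lambda>(f, g). (\<forall>x \<in> topspace X. f x = x) \<and> (\<forall>y \<in> topspace Y. g y = y))"

definition comp_isomorphic ::
    "'x topology \<Rightarrow> 'y topology \<Rightarrow> ('x \<Rightarrow> 'y) \<Rightarrow> 'u topology \<Rightarrow> 'v topology \<Rightarrow> ('u \<Rightarrow> 'v) \<Rightarrow> bool"
where
  "comp_isomorphic X Y e X' Y' e' \<longleftrightarrow>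
     (\<exists>m n. comp_morphism X Y e X' Y' e' m \<and> comp_morphism X' Y' e' X Y e n \<and>
        comp_is_identity X Y (comp_compose n m) \<and> comp_is_identity X' Y' (comp_compose m n))"


section \<open>De Vries algebras\<close>

locale complete_boolean_lattice = complete_lattice L for L (structure) +
  assumes meet_join_distrib:
    "\<lbrakk>a \<in> carrier L; b \<in> carrier L; c \<in> carrier L\<rbrakk> \<Longrightarrow> a \<sqinter> (b \<squnion> c) = (a \<sqinter> b) \<squnion> (a \<sqinter> c)"
    and complement_exists:
    "a \<in> carrier L \<Longrightarrow> \<exists>b \<in> carrier L. a \<sqinter> b = \<bottom> \<and> a \<squnion> b = \<top>"

definition complement :: "('a, 'm) gorder_scheme \<Rightarrow> 'a \<Rightarrow> 'a" (\<open>\<sim>\<index> _\<close> [81] 80) where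
  "\<sim>\<^bsub>L\<^esub> a = (THE b. b \<in> carrier L \<and> a \<sqinter>\<^bsub>L\<^esub> b = \<bottom>\<^bsub>L\<^esub> \<and> a \<squnion>\<^bsub>L\<^esub> b = \<top>\<^bsub>L\<^esub>)"

record 'a proximity_order = "'a gorder" +
  prox :: "'a \<Rightarrow> 'a \<Rightarrow> bool"  (infixl \<open>\<lless>\<index>\<close> 50)

locale de_vries_algebra = complete_boolean_lattice A for A (structure) +
  assumes DV1: "\<top> \<lless> \<top>"
    and DV2: "\<lbrakk>a \<in> carrier A; b \<in> carrier A; a \<lless> b\<rbrakk> \<Longrightarrow> a \<sqsubseteq> b"
    and DV3: "\<lbrakk>a \<in> carrier A; b \<in> carrier A; c \<in> carrier A; d \<in> carrier A;
               a \<sqsubseteq> b; b \<lless> c; c \<sqsubseteq> d\<rbrakk> \<Longrightarrow> a \<lless> d"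
    and DV4: "\<lbrakk>a \<in> carrier A; b \<in> carrier A; c \<in> carrier A; a \<lless> b; a \<lless> c\<rbrakk> \<Longrightarrow> a \<lless> b \<sqinter> c"
    and DV5: "\<lbrakk>a \<in> carrier A; b \<in> carrier A; a \<lless> b\<rbrakk> \<Longrightarrow> \<sim> b \<lless> \<sim> a"
    and DV6: "\<lbrakk>a \<in> carrier A; b \<in> carrier A; a \<lless> b\<rbrakk> \<Longrightarrow> \<exists>c \<in> carrier A. a \<lless> c \<and> c \<lless> b"
    and DV7: "\<lbrakk>b \<in> carrier A; b \<noteq> \<bottom>\<rbrakk> \<Longrightarrow> \<exists>a \<in> carrier A. a \<noteq> \<bottom> \<and> a \<lless> b"

definition extremally_disconnected :: "'a proximity_order \<Rightarrow> bool" where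
  "extremally_disconnected A \<longleftrightarrow>
     (\<forall>a \<in> carrier A. \<forall>b \<in> carrier A. a \<lless>\<^bsub>A\<^esub> b \<longleftrightarrow> a \<sqsubseteq>\<^bsub>A\<^esub> b)"

definition lattice_atom :: "('a, 'm) gorder_scheme \<Rightarrow> 'a \<Rightarrow> bool" where
  "lattice_atom L a \<longleftrightarrow> a \<in> carrier L \<and> a \<noteq> \<bottom>\<^bsub>L\<^esub> \<and>
     (\<forall>b \<in> carrier L. b \<sqsubseteq>\<^bsub>L\<^esub> a \<longrightarrow> b = \<bottom>\<^bsub>L\<^esub> \<or> b = a)"

definition atomic :: "('a, 'm) gorder_scheme \<Rightarrow> bool" where
  "atomic L \<longleftrightarrow> (\<forall>b \<in> carrier L. b \<noteq> \<bottom>\<^bsub>L\<^esub> \<longrightarrow> (\<exists>a. lattice_atom L a \<and> a \<sqsubseteq>\<^bsub>L\<^esub> b))"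

locale de_vries_morphism =
  source: de_vries_algebra A + target: de_vries_algebra B
  for A :: "'a proximity_order" and B :: "'b proximity_order" and \<rho> :: "'a \<Rightarrow> 'b" +
  assumes closed: "\<rho> \<in> carrier A \<rightarrow> carrier B"
    and M1: "\<rho> \<bottom>\<^bsub>A\<^esub> = \<bottom>\<^bsub>B\<^esub>"
    and M2: "\<lbrakk>a \<in> carrier A; b \<in> carrier A\<rbrakk> \<Longrightarrow> \<rho> (a \<sqinter>\<^bsub>A\<^esub> b) = \<rho> a \<sqinter>\<^bsub>B\<^esub> \<rho> b"
    and M3: "\<lbrakk>a \<in> carrier A; b \<in> carrier A; a \<lless>\<^bsub>A\<^esub> b\<rbrakk> \<Longrightarrow> \<sim>\<^bsub>B\<^esub> (\<rho> (\<sim>\<^bsub>A\<^esub> a)) \<lless>\<^bsub>B\<^esub> \<rho> b"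
    and M4: "b \<in> carrier A \<Longrightarrow> \<rho> b = \<Squnion>\<^bsub>B\<^esub> {\<rho> a | a. a \<in> carrier A \<and> a \<lless>\<^bsub>A\<^esub> b}"

text \<open>\<open>A\<close> is the source of \<open>\<rho>1\<close> and \<open>C\<close> is the target of \<open>\<rho>2\<close>.\<close>

definition dv_compose ::
    "'a proximity_order \<Rightarrow> 'c proximity_order \<Rightarrow> ('b \<Rightarrow> 'c) \<Rightarrow> ('a \<Rightarrow> 'b) \<Rightarrow> 'a \<Rightarrow> 'c" where
  "dv_compose A C \<rho>2 \<rho>1 b = \<Squnion>\<^bsub>C\<^esub> {\<rho>2 (\<rho>1 a) | a. a \<in> carrier A \<and> a \<lless>\<^bsub>A\<^esub> b}"

subsection \<open>De Vries extensions\<close>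

locale de_vries_extension = de_vries_morphism A B \<alpha>
  for A :: "'a proximity_order" and B :: "'b proximity_order" and \<alpha> :: "'a \<Rightarrow> 'b" +
  assumes inj: "inj_on \<alpha> (carrier A)"
    and target_extremally_disconnected: "extremally_disconnected B"
    and target_atomic: "atomic B"
    and join_of_meets: "b \<in> carrier B \<Longrightarrow>
      \<exists>\<T>. (\<forall>T \<in> \<T>. T \<subseteq> \<alpha> ` carrier A) \<and> b = \<Squnion>\<^bsub>B\<^esub> {\<Sqinter>\<^bsub>B\<^esub> T | T. T \<in> \<T>}"

definition compatible ::
    "'a proximity_order \<Rightarrow> ('a \<Rightarrow> 'b) \<Rightarrow> 'c proximity_order \<Rightarrow> ('c \<Rightarrow> 'b) \<Rightarrow> bool" where
  "compatible A \<alpha> C \<gamma> \<longleftrightarrow> \<alpha> ` carrier A = \<gamma> ` carrier C"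

text \<open>
  In a compatible extension \<open>\<gamma>\<close> of \<open>C\<close>, the map \<open>\<gamma>\<close> is a bijection from \<open>C\<close> onto the image of \<open>A\<close>,
  so \<open>C\<close> is isomorphic to a de Vries algebra on the carrier of \<open>A\<close>. Hence it is enough to let \<open>C\<close>
  range over the de Vries algebras in the type of \<open>A\<close>; the property then holds for \<open>C\<close> in any
  type: see \<open>maximal_extension_universal\<close> below.
\<close>

definition maximal_extension ::
    "'a proximity_order \<Rightarrow> 'b proximity_order \<Rightarrow> ('a \<Rightarrow> 'b) \<Rightarrow> bool" where
  "maximal_extension A B \<alpha> \<longleftrightarrow> de_vries_extension A B \<alpha> \<and>
     (\<forall>(C :: 'a proximity_order) \<gamma>. de_vries_extension C B \<gamma> \<and> compatible A \<alpha> C \<gamma> \<longrightarrow>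
        (\<exists>\<delta>. de_vries_morphism C A \<delta> \<and> (\<forall>c \<in> carrier C. dv_compose C B \<alpha> \<delta> c = \<gamma> c)))"

context complete_boolean_lattice
begin

lemma complement_unique:
  assumes "a \<in> carrier L" "b \<in> carrier L" "c \<in> carrier L"
    "a \<sqinter> b = \<bottom>" "a \<squnion> b = \<top>" "a \<sqinter> c = \<bottom>"
  shows "c \<sqsubseteq> b"
proof -
  have "c = c \<sqinter> (a \<squnion> b)"
    using assms top_higher[of c] le_iff_join[of c "\<top>"] by simp
  also have "\<dots> = (c \<sqinter> a) \<squnion> (c \<sqinter> b)"
    using assms by (intro meet_join_distrib)
  also have "\<dots> = c \<sqinter> b"
    using assms meet_comm[of L c a] le_iff_meet[of "\<bottom>" "c \<sqinter> b"] by simp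
  finally show ?thesis
    using assms meet_right[of c b] by simp
qed

lemma complement:
  assumes "a \<in> carrier L"
  shows "\<sim> a \<in> carrier L" "a \<sqinter> \<sim> a = \<bottom>" "a \<squnion> \<sim> a = \<top>"
proof -
  have "\<exists>!b. b \<in> carrier L \<and> a \<sqinter> b = \<bottom> \<and> a \<squnion> b = \<top>"
    using complement_exists[OF assms] complement_unique[OF assms] le_antisym by metis
  from theI'[OF this] show "\<sim> a \<in> carrier L" "a \<sqinter> \<sim> a = \<bottom>" "a \<squnion> \<sim> a = \<top>"
    unfolding complement_def by auto
qed

lemma le_complement:
  assumes "a \<in> carrier L" "c \<in> carrier L" "a \<sqinter> c = \<bottom>"
  shows "c \<sqsubseteq> \<sim> a"
  using complement_unique complement assms by metis

end

lemma (in de_vries_extension) le_iff: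
  assumes "a \<in> carrier A" "b \<in> carrier A"
  shows "\<alpha> a \<sqsubseteq>\<^bsub>B\<^esub> \<alpha> b \<longleftrightarrow> a \<sqsubseteq>\<^bsub>A\<^esub> b"
proof -
  have cl: "\<alpha> a \<in> carrier B" "\<alpha> b \<in> carrier B" using assms closed by auto
  have "\<alpha> a \<sqsubseteq>\<^bsub>B\<^esub> \<alpha> b \<longleftrightarrow> \<alpha> a \<sqinter>\<^bsub>B\<^esub> \<alpha> b = \<alpha> a"
    using cl target.le_iff_join[of "\<alpha> a" "\<alpha> b"] by auto
  also have "\<dots> \<longleftrightarrow> \<alpha> (a \<sqinter>\<^bsub>A\<^esub> b) = \<alpha> a"
    using M2 assms by simp
  also have "\<dots> \<longleftrightarrow> a \<sqinter>\<^bsub>A\<^esub> b = a"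
    using inj assms by (auto dest: inj_onD)
  also have "\<dots> \<longleftrightarrow> a \<sqsubseteq>\<^bsub>A\<^esub> b"
    using assms source.le_iff_join[of a b] by auto
  finally show ?thesis .
qed

lemma maximal_extension_universal:
  fixes A :: "'a proximity_order" and B :: "'b proximity_order" and C :: "'c proximity_order"
  assumes max: "maximal_extension A B \<alpha>"
    and \<gamma>: "de_vries_extension C B \<gamma>" and comp: "compatible A \<alpha> C \<gamma>"
  shows "\<exists>\<delta>. de_vries_morphism C A \<delta> \<and> (\<forall>c \<in> carrier C. dv_compose C B \<alpha> \<delta> c = \<gamma> c)"
proof -
  interpret A: de_vries_extension A B \<alpha> using max by (simp add: maximal_extension_def)
  interpret C: de_vries_extension C B \<gamma> by (rule \<gamma>)
  have img: "\<alpha> ` carrier A = \<gamma> ` carrier C" using comp by (simp add: compatible_def)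
  define h where "h c = inv_into (carrier A) \<alpha> (\<gamma> c)" for c
  define k where "k a = inv_into (carrier C) \<gamma> (\<alpha> a)" for a
  have h: "h c \<in> carrier A" "\<alpha> (h c) = \<gamma> c" if "c \<in> carrier C" for c
    using that img by (auto simp: h_def inv_into_into f_inv_into_f)
  have k: "k a \<in> carrier C" "\<gamma> (k a) = \<alpha> a" if "a \<in> carrier A" for a
    using that img by (auto simp: k_def inv_into_into f_inv_into_f simp flip: img)
  have injA: "a = b" if "\<alpha> a = \<alpha> b" "a \<in> carrier A" "b \<in> carrier A" for a b
    using that A.inj by (auto dest: inj_onD)
  have injC: "a = b" if "\<gamma> a = \<gamma> b" "a \<in> carrier C" "b \<in> carrier C" for a b
    using that C.inj by (auto dest: inj_onD)
  have kh: "k (h c) = c" if "c \<in> carrier C" for c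
    using that by (intro injC) (simp_all add: h k)
  have hk: "h (k a) = a" if "a \<in> carrier A" for a
    using that by (intro injA) (simp_all add: h k)
  have k_le: "k a \<sqsubseteq>\<^bsub>C\<^esub> k b \<longleftrightarrow> a \<sqsubseteq>\<^bsub>A\<^esub> b" if "a \<in> carrier A" "b \<in> carrier A" for a b
    using that A.le_iff[of a b] C.le_iff[of "k a" "k b"] by (simp add: k)
  have k_bot: "k \<bottom>\<^bsub>A\<^esub> = \<bottom>\<^bsub>C\<^esub>"
    by (intro injC) (simp_all add: k A.M1 C.M1)
  have k_meet: "k (a \<sqinter>\<^bsub>A\<^esub> b) = k a \<sqinter>\<^bsub>C\<^esub> k b" if "a \<in> carrier A" "b \<in> carrier A" for a b
    using that by (intro injC) (simp_all add: k A.M2 C.M2)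
  have h_bot: "h \<bottom>\<^bsub>C\<^esub> = \<bottom>\<^bsub>A\<^esub>"
    by (intro injA) (simp_all add: h A.M1 C.M1)
  have h_meet: "h (a \<sqinter>\<^bsub>C\<^esub> b) = h a \<sqinter>\<^bsub>A\<^esub> h b" if "a \<in> carrier C" "b \<in> carrier C" for a b
    using that by (intro injA) (simp_all add: h A.M2 C.M2)
  have k_top: "k \<top>\<^bsub>A\<^esub> = \<top>\<^bsub>C\<^esub>"
  proof -
    have "h \<top>\<^bsub>C\<^esub> \<sqsubseteq>\<^bsub>A\<^esub> \<top>\<^bsub>A\<^esub>" by (simp add: h)
    then have "\<top>\<^bsub>C\<^esub> \<sqsubseteq>\<^bsub>C\<^esub> k \<top>\<^bsub>A\<^esub>"
      using k_le[of "h \<top>\<^bsub>C\<^esub>" "\<top>\<^bsub>A\<^esub>"] by (simp add: h kh)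
    then show ?thesis by (intro C.source.le_antisym) (simp_all add: k)
  qed
  have k_compl: "k (\<sim>\<^bsub>A\<^esub> a) = \<sim>\<^bsub>C\<^esub> (k a)" if a: "a \<in> carrier A" for a
  proof (rule C.source.le_antisym)
    have "k a \<sqinter>\<^bsub>C\<^esub> k (\<sim>\<^bsub>A\<^esub> a) = \<bottom>\<^bsub>C\<^esub>"
      using a by (simp add: A.source.complement k_bot flip: k_meet)
    then show "k (\<sim>\<^bsub>A\<^esub> a) \<sqsubseteq>\<^bsub>C\<^esub> \<sim>\<^bsub>C\<^esub> (k a)"
      using a by (intro C.source.le_complement) (simp_all add: k A.source.complement)
    have "h (k a) \<sqinter>\<^bsub>A\<^esub> h (\<sim>\<^bsub>C\<^esub> (k a)) = \<bottom>\<^bsub>A\<^esub>"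
      using a by (simp add: k C.source.complement h_bot flip: h_meet)
    then have "h (\<sim>\<^bsub>C\<^esub> (k a)) \<sqsubseteq>\<^bsub>A\<^esub> \<sim>\<^bsub>A\<^esub> a"
      using a by (intro A.source.le_complement) (simp_all add: h k hk C.source.complement)
    then show "\<sim>\<^bsub>C\<^esub> (k a) \<sqsubseteq>\<^bsub>C\<^esub> k (\<sim>\<^bsub>A\<^esub> a)"
      using a k_le[of "h (\<sim>\<^bsub>C\<^esub> (k a))" "\<sim>\<^bsub>A\<^esub> a"]
      by (simp add: h k kh A.source.complement C.source.complement)
  qed (use a in \<open>simp_all add: k A.source.complement C.source.complement\<close>)
  have h_compl: "h (\<sim>\<^bsub>C\<^esub> c) = \<sim>\<^bsub>A\<^esub> (h c)" if "c \<in> carrier C" for c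
    using k_compl[of "h c"] that hk[of "\<sim>\<^bsub>A\<^esub> (h c)"]
    by (simp add: h kh A.source.complement)

  define C' where "C' = A\<lparr>prox := \<lambda>a b. k a \<lless>\<^bsub>C\<^esub> k b\<rparr>"
  have C'_simps: "carrier C' = carrier A" "gorder.le C' = gorder.le A" "eq C' = eq A"
    "a \<lless>\<^bsub>C'\<^esub> b \<longleftrightarrow> k a \<lless>\<^bsub>C\<^esub> k b" for a b
    by (simp_all add: C'_def)
  have Upper: "Upper C' = Upper A" and Lower: "Lower C' = Lower A"
    by (intro ext, simp add: Upper_def Lower_def C'_simps)+
  have least: "least C' = least A" and greatest: "greatest C' = greatest A"
    by (intro ext, simp add: least_def greatest_def C'_simps)+
  have ops: "Lattice.sup C' = Lattice.sup A" "Lattice.inf C' = Lattice.inf A"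
    "\<bottom>\<^bsub>C'\<^esub> = \<bottom>\<^bsub>A\<^esub>" "\<top>\<^bsub>C'\<^esub> = \<top>\<^bsub>A\<^esub>"
    by (simp_all add: Lattice.sup_def Lattice.inf_def fun_eq_iff bottom_def top_def
        Upper Lower least greatest C'_simps)
  have ops2: "join C' = join A" "meet C' = meet A"
    by (simp_all add: fun_eq_iff join_def meet_def ops)
  have compl: "complement C' = complement A"
    by (simp add: fun_eq_iff complement_def ops ops2 C'_simps)
  note C' = C'_simps ops ops2 compl Upper Lower least greatest
  have "partial_order C'"
    by unfold_locales
      (auto simp: C' A.source.eq_is_equal intro: A.source.le_trans A.source.le_antisym)
  then interpret C': partial_order C' .
  have dv: "de_vries_algebra C'"
  proof unfold_locales
    fix b assume b: "b \<in> carrier C'" "b \<noteq> \<bottom>\<^bsub>C'\<^esub>"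
    then have "k b \<in> carrier C" "k b \<noteq> \<bottom>\<^bsub>C\<^esub>"
      using hk[of b] h_bot by (auto simp: C' k)
    then obtain c where "c \<in> carrier C" "c \<noteq> \<bottom>\<^bsub>C\<^esub>" "c \<lless>\<^bsub>C\<^esub> k b"
      using C.source.DV7 by blast
    then show "\<exists>a\<in>carrier C'. a \<noteq> \<bottom>\<^bsub>C'\<^esub> \<and> a \<lless>\<^bsub>C'\<^esub> b"
      using k_bot kh[of c] by (intro bexI[of _ "h c"]) (metis C'_simps(4) ops(3), simp add: C' h)
  next
    fix a b assume "a \<in> carrier C'" "b \<in> carrier C'" "a \<lless>\<^bsub>C'\<^esub> b"
    then obtain c where "c \<in> carrier C" "k a \<lless>\<^bsub>C\<^esub> c" "c \<lless>\<^bsub>C\<^esub> k b"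
      using C.source.DV6[of "k a" "k b"] by (auto simp: C' k)
    then show "\<exists>c\<in>carrier C'. a \<lless>\<^bsub>C'\<^esub> c \<and> c \<lless>\<^bsub>C'\<^esub> b"
      by (intro bexI[of _ "h c"]) (auto simp: C' h kh)
  next
    show "\<top>\<^bsub>C'\<^esub> \<lless>\<^bsub>C'\<^esub> \<top>\<^bsub>C'\<^esub>" by (simp add: C' k_top C.source.DV1)
  next
    fix a b assume "a \<in> carrier C'" "b \<in> carrier C'" "a \<lless>\<^bsub>C'\<^esub> b"
    then show "a \<sqsubseteq>\<^bsub>C'\<^esub> b" using C.source.DV2[of "k a" "k b"] by (simp add: C' k k_le)
  next
    fix a b c d assume "a \<in> carrier C'" "b \<in> carrier C'" "c \<in> carrier C'" "d \<in> carrier C'"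
      "a \<sqsubseteq>\<^bsub>C'\<^esub> b" "b \<lless>\<^bsub>C'\<^esub> c" "c \<sqsubseteq>\<^bsub>C'\<^esub> d"
    then show "a \<lless>\<^bsub>C'\<^esub> d"
      using C.source.DV3[of "k a" "k b" "k c" "k d"] by (simp add: C' k k_le)
  next
    fix a b c assume "a \<in> carrier C'" "b \<in> carrier C'" "c \<in> carrier C'"
      "a \<lless>\<^bsub>C'\<^esub> b" "a \<lless>\<^bsub>C'\<^esub> c"
    then show "a \<lless>\<^bsub>C'\<^esub> b \<sqinter>\<^bsub>C'\<^esub> c"
      using C.source.DV4[of "k a" "k b" "k c"] by (simp add: C' k k_meet)
  next
    fix a b assume "a \<in> carrier C'" "b \<in> carrier C'" "a \<lless>\<^bsub>C'\<^esub> b"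
    then show "\<sim>\<^bsub>C'\<^esub> b \<lless>\<^bsub>C'\<^esub> \<sim>\<^bsub>C'\<^esub> a"
      using C.source.DV5[of "k a" "k b"] by (simp add: C' k k_compl)
  qed (simp_all add: C' A.source.sup_exists A.source.inf_exists A.source.meet_join_distrib
      A.source.complement_exists)
  then interpret C': de_vries_algebra C' .
  have k_image: "{f c | c. c \<in> carrier C \<and> c \<lless>\<^bsub>C\<^esub> d} =
      {f (k a) | a. a \<in> carrier C' \<and> a \<lless>\<^bsub>C'\<^esub> b}" if "b \<in> carrier A" "d = k b" for f :: "'c \<Rightarrow> 't" and b d
  proof -
    have "\<exists>a. f c = f (k a) \<and> a \<in> carrier A \<and> k a \<lless>\<^bsub>C\<^esub> d"
      if "c \<in> carrier C" "c \<lless>\<^bsub>C\<^esub> d" for c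
      using that by (intro exI[of _ "h c"]) (simp add: h kh)
    with that show ?thesis by (auto simp: C' k)
  qed
  have "de_vries_extension C' B \<alpha>"
  proof unfold_locales
    fix a b assume "a \<in> carrier C'" "b \<in> carrier C'" "a \<lless>\<^bsub>C'\<^esub> b"
    then show "\<sim>\<^bsub>B\<^esub> \<alpha> (\<sim>\<^bsub>C'\<^esub> a) \<lless>\<^bsub>B\<^esub> \<alpha> b"
      using C.M3[of "k a" "k b"]
      by (simp add: C' k A.source.complement flip: k_compl)
  next
    fix b assume "b \<in> carrier C'"
    then have b: "b \<in> carrier A" by (simp add: C')
    have "{\<gamma> (k a) | a. a \<in> carrier C' \<and> a \<lless>\<^bsub>C'\<^esub> b} = {\<alpha> a | a. a \<in> carrier C' \<and> a \<lless>\<^bsub>C'\<^esub> b}"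
      by (metis (no_types, lifting) C'_simps(1) k(2))
    with C.M4[OF k(1)[OF b]] show "\<alpha> b = \<Squnion>\<^bsub>B\<^esub>{\<alpha> a | a. a \<in> carrier C' \<and> a \<lless>\<^bsub>C'\<^esub> b}"
      using k_image[OF b refl, of \<gamma>] b by (simp add: k)
  qed (use A.closed A.inj A.target_extremally_disconnected A.target_atomic A.join_of_meets
      in \<open>auto simp: C' A.M1 A.M2\<close>)
  moreover have "compatible A \<alpha> C' \<alpha>"
    by (simp add: compatible_def C')
  ultimately obtain \<delta> where \<delta>: "de_vries_morphism C' A \<delta>"
      "\<And>a. a \<in> carrier C' \<Longrightarrow> dv_compose C' B \<alpha> \<delta> a = \<alpha> a"
    using max unfolding maximal_extension_def by blast
  interpret \<delta>: de_vries_morphism C' A \<delta> by (rule \<delta>)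
  have \<delta>h: "{f (\<delta> (h c)) | c. c \<in> carrier C \<and> c \<lless>\<^bsub>C\<^esub> d} =
      {f (\<delta> a) | a. a \<in> carrier C' \<and> a \<lless>\<^bsub>C'\<^esub> h d}" if "d \<in> carrier C" for f :: "'a \<Rightarrow> 't" and d
  proof -
    have "{f (\<delta> (h c)) | c. c \<in> carrier C \<and> c \<lless>\<^bsub>C\<^esub> d} =
        {f (\<delta> (h (k a))) | a. a \<in> carrier C' \<and> a \<lless>\<^bsub>C'\<^esub> h d}"
      using k_image[of "h d" d "\<lambda>c. f (\<delta> (h c))"] that by (simp add: h kh)
    also have "\<dots> = {f (\<delta> a) | a. a \<in> carrier C' \<and> a \<lless>\<^bsub>C'\<^esub> h d}"
      by (metis (no_types, lifting) C'_simps(1) hk)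
    finally show ?thesis .
  qed
  have "de_vries_morphism C A (\<delta> \<circ> h)"
  proof unfold_locales
    show "\<delta> \<circ> h \<in> carrier C \<rightarrow> carrier A" using \<delta>.closed by (auto simp: C' h)
    show "(\<delta> \<circ> h) \<bottom>\<^bsub>C\<^esub> = \<bottom>\<^bsub>A\<^esub>" using \<delta>.M1 by (simp add: C' h_bot)
  next
    fix a b assume "a \<in> carrier C" "b \<in> carrier C"
    then show "(\<delta> \<circ> h) (a \<sqinter>\<^bsub>C\<^esub> b) = (\<delta> \<circ> h) a \<sqinter>\<^bsub>A\<^esub> (\<delta> \<circ> h) b"
      using \<delta>.M2[of "h a" "h b"] by (simp add: C' h h_meet)
  next
    fix a b assume "a \<in> carrier C" "b \<in> carrier C" "a \<lless>\<^bsub>C\<^esub> b"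
    then show "\<sim>\<^bsub>A\<^esub> (\<delta> \<circ> h) (\<sim>\<^bsub>C\<^esub> a) \<lless>\<^bsub>A\<^esub> (\<delta> \<circ> h) b"
      using \<delta>.M3[of "h a" "h b"] by (simp add: C' h kh h_compl)
  next
    fix b assume "b \<in> carrier C"
    then show "(\<delta> \<circ> h) b = \<Squnion>\<^bsub>A\<^esub>{(\<delta> \<circ> h) a | a. a \<in> carrier C \<and> a \<lless>\<^bsub>C\<^esub> b}"
      using \<delta>.M4[of "h b"] \<delta>h[of b "\<lambda>x. x"] by (simp add: C'_simps(1) h)
  qed
  moreover have "dv_compose C B \<alpha> (\<delta> \<circ> h) c = \<gamma> c" if "c \<in> carrier C" for c
    using \<delta>(2)[of "h c"] \<delta>h[OF that, of \<alpha>] that by (simp add: dv_compose_def C'_simps(1) h)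
  ultimately show ?thesis by blast
qed

subsection \<open>The extension of a compactification\<close>

text \<open>
  The Boolean structure of both algebras is the one determined by inclusion. For regular open sets,
  binary meet is intersection, the join of a family is the interior of the closure of its union,
  and the complement of \<open>U\<close> is the interior of its set complement.
\<close>

definition regular_openin :: "'y topology \<Rightarrow> 'y set \<Rightarrow> bool" where
  "regular_openin Y U \<longleftrightarrow> Y interior_of (Y closure_of U) = U"

definition regular_open_algebra :: "'y topology \<Rightarrow> 'y set proximity_order" where
  "regular_open_algebra Y =
     \<lparr>carrier = {U. regular_openin Y U}, eq = (=), le = (\<subseteq>),
      prox = (\<lambda>U V. Y closure_of U \<subseteq> V)\<rparr>"

definition powerset_algebra :: "'x topology \<Rightarrow> 'x set proximity_order" where
  "powerset_algebra X =
     \<lparr>carrier = Pow (topspace X), eq = (=), le = (\<subseteq>), prox = (\<subseteq>)\<rparr>"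

definition preimage_map :: "'x topology \<Rightarrow> ('x \<Rightarrow> 'y) \<Rightarrow> 'y set \<Rightarrow> 'x set" where
  "preimage_map X e U = {x \<in> topspace X. e x \<in> U}"

lemma (in partial_order) sup_eqI: "least L s (Upper L A) \<Longrightarrow> \<Squnion>A = s"
  unfolding sup_def by (rule some_equality) (auto intro: least_unique)

lemma (in partial_order) inf_eqI: "greatest L s (Lower L A) \<Longrightarrow> \<Sqinter>A = s"
  unfolding inf_def by (rule some_equality) (auto intro: greatest_unique)

lemma (in complete_boolean_lattice) complement_eqI:
  assumes "a \<in> carrier L" "b \<in> carrier L" "a \<sqinter> b = \<bottom>" "a \<squnion> b = \<top>"
  shows "\<sim> a = b"
proof (rule le_antisym)
  note c = complement[OF assms(1)]
  show "\<sim> a \<sqsubseteq> b" using complement_unique[OF assms(1,2) c(1) assms(3,4) c(2)] .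
  show "b \<sqsubseteq> \<sim> a" using le_complement[OF assms(1-3)] .
qed (use assms complement in auto)

lemma powerset_algebra_simps [simp]:
  "carrier (powerset_algebra X) = Pow (topspace X)"
  "eq (powerset_algebra X) = (=)"
  "a \<sqsubseteq>\<^bsub>powerset_algebra X\<^esub> b \<longleftrightarrow> a \<subseteq> b"
  "a \<lless>\<^bsub>powerset_algebra X\<^esub> b \<longleftrightarrow> a \<subseteq> b"
  by (simp_all add: powerset_algebra_def)

lemma partial_order_powerset: "partial_order (powerset_algebra X)"
  by unfold_locales auto

lemma powerset_least:
  "S \<subseteq> Pow (topspace X) \<Longrightarrow> least (powerset_algebra X) (\<Union>S) (Upper (powerset_algebra X) S)"
  by (fastforce simp: least_def Upper_def)

lemma powerset_greatest:
  "S \<subseteq> Pow (topspace X) \<Longrightarrow>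
   greatest (powerset_algebra X) (topspace X \<inter> \<Inter>S) (Lower (powerset_algebra X) S)"
  by (fastforce simp: greatest_def Lower_def)

lemma powerset_ops:
  shows powerset_sup: "S \<subseteq> Pow (topspace X) \<Longrightarrow> \<Squnion>\<^bsub>powerset_algebra X\<^esub> S = \<Union>S"
    and powerset_inf: "S \<subseteq> Pow (topspace X) \<Longrightarrow> \<Sqinter>\<^bsub>powerset_algebra X\<^esub> S = topspace X \<inter> \<Inter>S"
    and powerset_join: "\<lbrakk>a \<subseteq> topspace X; b \<subseteq> topspace X\<rbrakk> \<Longrightarrow> a \<squnion>\<^bsub>powerset_algebra X\<^esub> b = a \<union> b"
    and powerset_meet: "\<lbrakk>a \<subseteq> topspace X; b \<subseteq> topspace X\<rbrakk> \<Longrightarrow> a \<sqinter>\<^bsub>powerset_algebra X\<^esub> b = a \<inter> b"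
    and powerset_bottom: "\<bottom>\<^bsub>powerset_algebra X\<^esub> = {}"
    and powerset_top: "\<top>\<^bsub>powerset_algebra X\<^esub> = topspace X"
proof -
  interpret partial_order "powerset_algebra X" by (rule partial_order_powerset)
  show 1: "S \<subseteq> Pow (topspace X) \<Longrightarrow> \<Squnion>\<^bsub>powerset_algebra X\<^esub> S = \<Union>S" for S
    by (intro sup_eqI powerset_least)
  show 2: "S \<subseteq> Pow (topspace X) \<Longrightarrow> \<Sqinter>\<^bsub>powerset_algebra X\<^esub> S = topspace X \<inter> \<Inter>S" for S
    by (intro inf_eqI powerset_greatest)
  show "\<lbrakk>a \<subseteq> topspace X; b \<subseteq> topspace X\<rbrakk> \<Longrightarrow> a \<squnion>\<^bsub>powerset_algebra X\<^esub> b = a \<union> b"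
    by (simp add: join_def 1)
  show "\<lbrakk>a \<subseteq> topspace X; b \<subseteq> topspace X\<rbrakk> \<Longrightarrow> a \<sqinter>\<^bsub>powerset_algebra X\<^esub> b = a \<inter> b"
    by (auto simp add: meet_def 2)
  show "\<bottom>\<^bsub>powerset_algebra X\<^esub> = {}"
    unfolding bottom_def by (rule some_equality) (auto simp: least_def)
  show "\<top>\<^bsub>powerset_algebra X\<^esub> = topspace X"
    unfolding top_def by (rule some_equality) (auto simp: greatest_def)
qed

lemma complete_boolean_lattice_powerset: "complete_boolean_lattice (powerset_algebra X)"
proof -
  interpret partial_order "powerset_algebra X" by (rule partial_order_powerset)
  show ?thesis
  proof unfold_locales
    fix a assume "a \<in> carrier (powerset_algebra X)"
    then show "\<exists>b\<in>carrier (powerset_algebra X). a \<sqinter>\<^bsub>powerset_algebra X\<^esub> b = \<bottom>\<^bsub>powerset_algebra X\<^esub> \<and>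
        a \<squnion>\<^bsub>powerset_algebra X\<^esub> b = \<top>\<^bsub>powerset_algebra X\<^esub>"
      by (intro bexI[of _ "topspace X - a"]) (auto simp: powerset_ops)
  next
    fix a b c assume "a \<in> carrier (powerset_algebra X)" "b \<in> carrier (powerset_algebra X)"
      "c \<in> carrier (powerset_algebra X)"
    then show "a \<sqinter>\<^bsub>powerset_algebra X\<^esub> (b \<squnion>\<^bsub>powerset_algebra X\<^esub> c) =
        (a \<sqinter>\<^bsub>powerset_algebra X\<^esub> b) \<squnion>\<^bsub>powerset_algebra X\<^esub> (a \<sqinter>\<^bsub>powerset_algebra X\<^esub> c)"
      by (simp add: powerset_ops le_infI1 Int_Un_distrib)
  qed (auto intro: powerset_least powerset_greatest)
qed

lemma powerset_complement:
  "a \<subseteq> topspace X \<Longrightarrow> \<sim>\<^bsub>powerset_algebra X\<^esub> a = topspace X - a"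
  by (rule complete_boolean_lattice.complement_eqI[OF complete_boolean_lattice_powerset])
    (auto simp: powerset_ops)

lemma de_vries_algebra_powerset: "de_vries_algebra (powerset_algebra X)"
proof -
  interpret complete_boolean_lattice "powerset_algebra X"
    by (rule complete_boolean_lattice_powerset)
  show ?thesis
    by unfold_locales (auto simp: powerset_ops powerset_complement)
qed

lemma regular_open_simps [simp]:
  "carrier (regular_open_algebra Y) = {U. regular_openin Y U}"
  "eq (regular_open_algebra Y) = (=)"
  "U \<sqsubseteq>\<^bsub>regular_open_algebra Y\<^esub> V \<longleftrightarrow> U \<subseteq> V"
  "U \<lless>\<^bsub>regular_open_algebra Y\<^esub> V \<longleftrightarrow> Y closure_of U \<subseteq> V"
  by (simp_all add: regular_open_algebra_def)

lemma partial_order_regular_open: "partial_order (regular_open_algebra Y)"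
  by unfold_locales auto

lemma regular_openin_openin: "regular_openin Y U \<Longrightarrow> openin Y U"
  unfolding regular_openin_def by (metis openin_interior_of)

lemma regular_openin_subset: "regular_openin Y U \<Longrightarrow> U \<subseteq> topspace Y"
  by (simp add: openin_subset regular_openin_openin)

lemma regular_openin_subset_closure: "regular_openin Y U \<Longrightarrow> U \<subseteq> Y closure_of U"
  by (simp add: closure_of_subset regular_openin_subset)

lemma interior_closure_mono:
  "U \<subseteq> V \<Longrightarrow> Y interior_of (Y closure_of U) \<subseteq> Y interior_of (Y closure_of V)"
  by (simp add: closure_of_mono interior_of_mono)

lemma interior_closure_increasing: "openin Y U \<Longrightarrow> U \<subseteq> Y interior_of (Y closure_of U)"
  by (simp add: closure_of_subset interior_of_maximal openin_subset)

lemma closure_interior_closure: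
  "Y closure_of (Y interior_of (Y closure_of U)) \<subseteq> Y closure_of U"
  by (intro closure_of_minimal) (auto simp: interior_of_subset)

lemma regular_openin_interior_closure [simp]: "regular_openin Y (Y interior_of (Y closure_of U))"
  unfolding regular_openin_def
  by (intro subset_antisym interior_closure_increasing interior_of_mono closure_interior_closure)
    simp

lemma interior_closure_least:
  "\<lbrakk>U \<subseteq> V; regular_openin Y V\<rbrakk> \<Longrightarrow> Y interior_of (Y closure_of U) \<subseteq> V"
  using interior_closure_mono[of U V Y] by (simp add: regular_openin_def)

lemma regular_openin_empty [simp]: "regular_openin Y {}"
  and regular_openin_topspace [simp]: "regular_openin Y (topspace Y)"
  by (simp_all add: regular_openin_def)

lemma regular_open_least:
  assumes "S \<subseteq> carrier (regular_open_algebra Y)"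
  shows "least (regular_open_algebra Y) (Y interior_of (Y closure_of \<Union>S))
    (Upper (regular_open_algebra Y) S)"
proof -
  have "openin Y (\<Union>S)" using assms by (auto intro: regular_openin_openin)
  then have "U \<subseteq> Y interior_of (Y closure_of \<Union>S)" if "U \<in> S" for U
    using interior_closure_increasing that by blast
  moreover have "Y interior_of (Y closure_of \<Union>S) \<subseteq> V"
    if "regular_openin Y V" "\<forall>U \<in> S. U \<subseteq> V" for V
    using that by (intro interior_closure_least) auto
  ultimately show ?thesis using assms
    by (simp add: least_def Upper_def) blast
qed

lemma regular_open_greatest:
  assumes "S \<subseteq> carrier (regular_open_algebra Y)"
  shows "greatest (regular_open_algebra Y)
    (Y interior_of (Y closure_of (Y interior_of (topspace Y \<inter> \<Inter>S)))) (Lower (regular_open_algebra Y) S)"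
proof -
  let ?I = "Y interior_of (topspace Y \<inter> \<Inter>S)"
  have "Y interior_of (Y closure_of ?I) \<subseteq> U" if "U \<in> S" for U
  proof -
    have "?I \<subseteq> U" using that interior_of_subset[of Y "topspace Y \<inter> \<Inter>S"] by blast
    then show ?thesis using assms that by (intro interior_closure_least) auto
  qed
  moreover have "V \<subseteq> Y interior_of (Y closure_of ?I)"
    if "regular_openin Y V" "\<forall>U \<in> S. V \<subseteq> U" for V
  proof -
    have "V \<subseteq> ?I"
      using that by (intro interior_of_maximal) (auto dest: regular_openin_subset regular_openin_openin)
    then show ?thesis
      using interior_closure_increasing[of Y ?I] by simp
  qed
  ultimately show ?thesis using assms
    by (simp add: greatest_def Lower_def) blast
qed

lemma regular_openin_Int:
  assumes "regular_openin Y U" "regular_openin Y V"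
  shows "regular_openin Y (U \<inter> V)"
  using assms unfolding regular_openin_def[of Y "U \<inter> V"]
  by (intro subset_antisym Int_greatest interior_closure_least interior_closure_increasing
      openin_Int regular_openin_openin) auto

lemma regular_open_ops:
  fixes Y :: "'y topology"
  defines "R \<equiv> regular_open_algebra Y"
  shows regular_open_sup: "S \<subseteq> carrier R \<Longrightarrow> \<Squnion>\<^bsub>R\<^esub> S = Y interior_of (Y closure_of \<Union>S)"
    and regular_open_join: "\<lbrakk>a \<in> carrier R; b \<in> carrier R\<rbrakk> \<Longrightarrow>
      a \<squnion>\<^bsub>R\<^esub> b = Y interior_of (Y closure_of (a \<union> b))"
    and regular_open_meet: "\<lbrakk>a \<in> carrier R; b \<in> carrier R\<rbrakk> \<Longrightarrow> a \<sqinter>\<^bsub>R\<^esub> b = a \<inter> b"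
    and regular_open_bottom: "\<bottom>\<^bsub>R\<^esub> = {}"
    and regular_open_top: "\<top>\<^bsub>R\<^esub> = topspace Y"
proof -
  interpret partial_order R unfolding R_def by (rule partial_order_regular_open)
  show 1: "S \<subseteq> carrier R \<Longrightarrow> \<Squnion>\<^bsub>R\<^esub> S = Y interior_of (Y closure_of \<Union>S)" for S
    by (intro sup_eqI) (simp add: R_def regular_open_least)
  show "\<lbrakk>a \<in> carrier R; b \<in> carrier R\<rbrakk> \<Longrightarrow> a \<squnion>\<^bsub>R\<^esub> b = Y interior_of (Y closure_of (a \<union> b))"
    by (simp add: join_def 1)
  show "\<lbrakk>a \<in> carrier R; b \<in> carrier R\<rbrakk> \<Longrightarrow> a \<sqinter>\<^bsub>R\<^esub> b = a \<inter> b"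
    unfolding meet_def
    by (rule inf_eqI) (auto simp: R_def greatest_def Lower_def regular_openin_Int)
  have bot: "least R {} (carrier R)" and top: "greatest R (topspace Y) (carrier R)"
    by (simp_all add: R_def least_def greatest_def regular_openin_subset)
  show "\<bottom>\<^bsub>R\<^esub> = {}"
    unfolding bottom_def using bot by (rule some_equality) (rule least_unique[OF _ bot])
  show "\<top>\<^bsub>R\<^esub> = topspace Y"
    unfolding top_def using top by (rule some_equality) (rule greatest_unique[OF _ top])
qed

lemma regular_open_compl:
  assumes "openin Y U"
  shows "regular_openin Y (topspace Y - Y closure_of U)"
    "Y interior_of (Y closure_of (U \<union> (topspace Y - Y closure_of U))) = topspace Y"
proof -
  have "Y interior_of (Y closure_of (topspace Y - Y closure_of U)) \<subseteq> topspace Y - Y closure_of U"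
  proof -
    have "Y closure_of (topspace Y - Y closure_of U) \<subseteq> topspace Y - U"
      using assms by (intro closure_of_minimal) (auto dest: closure_of_subset openin_subset)
    then show ?thesis
      by (metis interior_of_complement interior_of_mono)
  qed
  moreover have "openin Y (topspace Y - Y closure_of U)"
    by (rule openin_diff) simp_all
  ultimately show "regular_openin Y (topspace Y - Y closure_of U)"
    unfolding regular_openin_def by (intro subset_antisym interior_closure_increasing)
  have "topspace Y \<subseteq> Y closure_of (U \<union> (topspace Y - Y closure_of U))"
    using closure_of_subset[of "topspace Y - Y closure_of U" Y] unfolding closure_of_Un by blast
  then have "Y closure_of (U \<union> (topspace Y - Y closure_of U)) = topspace Y"
    by (intro subset_antisym closure_of_subset_topspace)
  then show "Y interior_of (Y closure_of (U \<union> (topspace Y - Y closure_of U))) = topspace Y"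
    by simp
qed

lemma complete_boolean_lattice_regular_open: "complete_boolean_lattice (regular_open_algebra Y)"
proof -
  let ?R = "regular_open_algebra Y"
  interpret partial_order ?R by (rule partial_order_regular_open)
  interpret complete_lattice ?R
    by unfold_locales (rule exI, erule regular_open_least, rule exI, erule regular_open_greatest)
  show ?thesis
  proof unfold_locales
    fix a assume "a \<in> carrier ?R"
    then show "\<exists>b\<in>carrier ?R. a \<sqinter>\<^bsub>?R\<^esub> b = \<bottom>\<^bsub>?R\<^esub> \<and> a \<squnion>\<^bsub>?R\<^esub> b = \<top>\<^bsub>?R\<^esub>"
      using regular_open_compl[of Y a, OF regular_openin_openin] regular_openin_subset_closure[of Y a]
      by (intro bexI[of _ "topspace Y - Y closure_of a"])
        (auto simp add: regular_open_ops simp del: closure_of_Un)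
  next
    fix a b c assume a: "a \<in> carrier ?R" and b: "b \<in> carrier ?R" and c: "c \<in> carrier ?R"
    have "a \<inter> Y interior_of (Y closure_of (b \<union> c)) \<subseteq> Y interior_of (Y closure_of (a \<inter> (b \<union> c)))"
    proof (rule interior_of_maximal)
      have "openin Y a" using a by (simp add: regular_openin_openin)
      then show "openin Y (a \<inter> Y interior_of (Y closure_of (b \<union> c)))" by (simp add: openin_Int)
      show "a \<inter> Y interior_of (Y closure_of (b \<union> c)) \<subseteq> Y closure_of (a \<inter> (b \<union> c))"
        using openin_Int_closure_of_subset[OF \<open>openin Y a\<close>, of "b \<union> c"]
          interior_of_subset[of Y "Y closure_of (b \<union> c)"] by blast
    qed
    moreover have "Y interior_of (Y closure_of (a \<inter> (b \<union> c))) \<subseteq> a \<inter> Y interior_of (Y closure_of (b \<union> c))"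
      using a by (intro Int_greatest interior_closure_least interior_closure_mono) auto
    ultimately have "a \<inter> Y interior_of (Y closure_of (b \<union> c)) = Y interior_of (Y closure_of ((a \<inter> b) \<union> (a \<inter> c)))"
      by (metis Int_Un_distrib subset_antisym)
    then show "a \<sqinter>\<^bsub>?R\<^esub> (b \<squnion>\<^bsub>?R\<^esub> c) = (a \<sqinter>\<^bsub>?R\<^esub> b) \<squnion>\<^bsub>?R\<^esub> (a \<sqinter>\<^bsub>?R\<^esub> c)"
      using a b c by (simp add: regular_open_ops regular_openin_Int del: closure_of_Un)
  qed
qed

lemma regular_open_complement:
  assumes "regular_openin Y a"
  shows "\<sim>\<^bsub>regular_open_algebra Y\<^esub> a = topspace Y - Y closure_of a"
  using assms regular_open_compl[of Y a, OF regular_openin_openin] regular_openin_subset_closure[of Y a]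
  by (intro complete_boolean_lattice.complement_eqI[OF complete_boolean_lattice_regular_open])
    (auto simp add: regular_open_ops simp del: closure_of_Un)

lemma regular_open_neighbourhood:
  assumes "regular_space Y" "openin Y V" "y \<in> V"
  obtains U where "regular_openin Y U" "y \<in> U" "Y closure_of U \<subseteq> V"
proof -
  have "closedin Y (topspace Y - V)" "y \<in> topspace Y - (topspace Y - V)"
    using assms by (auto dest: openin_subset)
  then obtain W where W: "openin Y W" "y \<in> W" "disjnt (topspace Y - V) (Y closure_of W)"
    using assms(1) unfolding regular_space by blast
  show thesis
  proof
    show "y \<in> Y interior_of (Y closure_of W)" using W interior_closure_increasing by blast
    show "Y closure_of (Y interior_of (Y closure_of W)) \<subseteq> V"
      using W(3) closure_interior_closure[of Y W] closure_of_subset_topspace[of Y W]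
      unfolding disjnt_def by blast
  qed simp
qed

lemma de_vries_algebra_regular_open:
  assumes "compact_space Y" "Hausdorff_space Y"
  shows "de_vries_algebra (regular_open_algebra Y)"
proof -
  let ?R = "regular_open_algebra Y"
  interpret complete_boolean_lattice ?R by (rule complete_boolean_lattice_regular_open)
  have reg: "regular_space Y" and norm: "normal_space Y"
    using assms compact_Hausdorff_imp_regular_space compact_Hausdorff_or_regular_imp_normal_space
    by blast+
  show ?thesis
  proof unfold_locales
    fix a b assume a: "a \<in> carrier ?R" and b: "b \<in> carrier ?R" and ab: "a \<lless>\<^bsub>?R\<^esub> b"
    show "a \<sqsubseteq>\<^bsub>?R\<^esub> b"
      using a ab regular_openin_subset_closure[of Y a] by auto
    have "Y closure_of (topspace Y - Y closure_of b) \<subseteq> topspace Y - b"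
      using b regular_openin_subset_closure[of Y b]
      by (intro closure_of_minimal) (auto simp: regular_openin_openin)
    then show "\<sim>\<^bsub>?R\<^esub> b \<lless>\<^bsub>?R\<^esub> \<sim>\<^bsub>?R\<^esub> a"
      using a b ab by (auto simp: regular_open_complement)
    obtain W where W: "openin Y W" "Y closure_of a \<subseteq> W" "Y closure_of W \<subseteq> b"
      using norm a b ab regular_openin_openin[of Y b] unfolding normal_space_alt
      by (metis (mono_tags, lifting) closedin_closure_of mem_Collect_eq regular_open_simps(1,4))
    show "\<exists>c\<in>carrier ?R. a \<lless>\<^bsub>?R\<^esub> c \<and> c \<lless>\<^bsub>?R\<^esub> b"
      using W interior_closure_increasing[OF W(1)] closure_interior_closure[of Y W]
      by (intro bexI[of _ "Y interior_of (Y closure_of W)"]) auto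
  next
    fix b assume b: "b \<in> carrier ?R" "b \<noteq> \<bottom>\<^bsub>?R\<^esub>"
    then obtain y where "y \<in> b" by (auto simp: regular_open_ops)
    with b obtain U where "regular_openin Y U" "y \<in> U" "Y closure_of U \<subseteq> b"
      using regular_open_neighbourhood[OF reg, of b y] regular_openin_openin[of Y b] by auto
    then show "\<exists>a\<in>carrier ?R. a \<noteq> \<bottom>\<^bsub>?R\<^esub> \<and> a \<lless>\<^bsub>?R\<^esub> b"
      by (intro bexI[of _ U]) (auto simp: regular_open_ops)
  next
    fix a b c d assume "a \<sqsubseteq>\<^bsub>?R\<^esub> b" "b \<lless>\<^bsub>?R\<^esub> c" "c \<sqsubseteq>\<^bsub>?R\<^esub> d"
    then show "a \<lless>\<^bsub>?R\<^esub> d" using closure_of_mono[of a b Y] by auto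
  qed (auto simp: regular_open_ops)
qed

lemma de_vries_extension_compactification:
  assumes "compactification X Y e"
  shows "de_vries_extension (regular_open_algebra Y) (powerset_algebra X) (preimage_map X e)"
proof -
  have comp: "compact_space Y" and haus: "Hausdorff_space Y" and emb: "embedding_map X Y e"
    and dense: "Y closure_of (e ` topspace X) = topspace Y"
    using assms by (auto simp: compactification_def)
  have reg: "regular_space Y" using comp haus by (rule compact_Hausdorff_imp_regular_space)
  have eX: "\<And>x. x \<in> topspace X \<Longrightarrow> e x \<in> topspace Y" using embedding_map_image[OF emb] by blast
  have inj: "inj_on e (topspace X)"
    using emb by (simp add: embedding_map_def homeomorphic_imp_injective_map)
  have sub: "preimage_map X e U \<subseteq> topspace X" for U by (auto simp: preimage_map_def)
  interpret R: de_vries_algebra "regular_open_algebra Y"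
    by (rule de_vries_algebra_regular_open[OF comp haus])
  interpret P: de_vries_algebra "powerset_algebra X" by (rule de_vries_algebra_powerset)
  show ?thesis
  proof unfold_locales
    show "preimage_map X e \<in> carrier (regular_open_algebra Y) \<rightarrow> carrier (powerset_algebra X)"
      using sub by auto
    show "preimage_map X e \<bottom>\<^bsub>regular_open_algebra Y\<^esub> = \<bottom>\<^bsub>powerset_algebra X\<^esub>"
      by (simp add: regular_open_ops powerset_ops preimage_map_def)
  next
    fix a b assume a: "a \<in> carrier (regular_open_algebra Y)" and b: "b \<in> carrier (regular_open_algebra Y)"
    then show "preimage_map X e (a \<sqinter>\<^bsub>regular_open_algebra Y\<^esub> b) =
        preimage_map X e a \<sqinter>\<^bsub>powerset_algebra X\<^esub> preimage_map X e b"
      by (auto simp: regular_open_ops powerset_ops sub) (auto simp: preimage_map_def)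
    assume "a \<lless>\<^bsub>regular_open_algebra Y\<^esub> b"
    then show "\<sim>\<^bsub>powerset_algebra X\<^esub> (preimage_map X e (\<sim>\<^bsub>regular_open_algebra Y\<^esub> a))
        \<lless>\<^bsub>powerset_algebra X\<^esub> preimage_map X e b"
      using a b eX
      by (auto simp: regular_open_complement powerset_complement sub) (auto simp: preimage_map_def)
  next
    fix b assume b: "b \<in> carrier (regular_open_algebra Y)"
    let ?S = "{preimage_map X e a | a. a \<in> carrier (regular_open_algebra Y) \<and> a \<lless>\<^bsub>regular_open_algebra Y\<^esub> b}"
    have "preimage_map X e b \<subseteq> \<Union>?S"
    proof
      fix x assume x: "x \<in> preimage_map X e b"
      then obtain U where "regular_openin Y U" "e x \<in> U" "Y closure_of U \<subseteq> b"
        using regular_open_neighbourhood[OF reg, of b "e x"] regular_openin_openin[of Y b] b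
        by (auto simp: preimage_map_def)
      then show "x \<in> \<Union>?S"
        using x by (intro UnionI[of "preimage_map X e U"]) (auto simp: preimage_map_def)
    qed
    moreover have "\<Union>?S \<subseteq> preimage_map X e b"
      using R.DV2[OF _ b] by (fastforce simp: preimage_map_def)
    moreover have "?S \<subseteq> Pow (topspace X)" using sub by auto
    ultimately show "preimage_map X e b = \<Squnion>\<^bsub>powerset_algebra X\<^esub> ?S"
      by (simp only: powerset_sup subset_antisym)
  next
    have le: "U \<subseteq> V" if U: "regular_openin Y U" and V: "regular_openin Y V"
      and eq: "preimage_map X e U = preimage_map X e V" for U V
    proof -
      have "U \<subseteq> Y closure_of (e ` topspace X)" using dense regular_openin_subset[OF U] by simp
      then have "Y closure_of U = Y closure_of (U \<inter> e ` topspace X)"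
        using closure_of_openin_Int_superset regular_openin_openin[OF U] by metis
      also have "U \<inter> e ` topspace X \<subseteq> V" using eq by (auto simp: preimage_map_def)
      then have "Y closure_of (U \<inter> e ` topspace X) \<subseteq> Y closure_of V" by (rule closure_of_mono)
      finally have "Y interior_of (Y closure_of U) \<subseteq> Y interior_of (Y closure_of V)"
        by (rule interior_of_mono)
      with U V show ?thesis by (simp add: regular_openin_def)
    qed
    show "inj_on (preimage_map X e) (carrier (regular_open_algebra Y))"
      by (rule inj_onI, rule subset_antisym) (use le in simp_all)
  next
    show "extremally_disconnected (powerset_algebra X)" by (simp add: extremally_disconnected_def)
    show "atomic (powerset_algebra X)"
      unfolding atomic_def
    proof (intro ballI impI)
      fix b assume "b \<in> carrier (powerset_algebra X)" "b \<noteq> \<bottom>\<^bsub>powerset_algebra X\<^esub>"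
      then obtain x where "x \<in> b" "x \<in> topspace X" by (auto simp: powerset_ops)
      then show "\<exists>a. lattice_atom (powerset_algebra X) a \<and> a \<sqsubseteq>\<^bsub>powerset_algebra X\<^esub> b"
        by (intro exI[of _ "{x}"]) (auto simp: lattice_atom_def powerset_ops)
    qed
  next
    fix b assume "b \<in> carrier (powerset_algebra X)"
    then have b: "b \<subseteq> topspace X" by simp
    define T where "T x = preimage_map X e ` {U. regular_openin Y U \<and> e x \<in> U}" for x
    have inf: "\<Sqinter>\<^bsub>powerset_algebra X\<^esub> (T x) = {x}" if x: "x \<in> topspace X" for x
    proof -
      have "z = x" if z: "z \<in> topspace X" "z \<in> \<Inter> (T x)" for z
      proof (rule ccontr)
        assume "z \<noteq> x"
        then have "e z \<noteq> e x" using inj x z by (auto dest: inj_onD)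
        moreover have "openin Y (topspace Y - {e z})"
          using haus eX[OF z(1)] Hausdorff_imp_t1_space t1_space_closedin_singleton
          by (metis openin_diff openin_topspace)
        ultimately obtain U where "regular_openin Y U" "e x \<in> U"
            "Y closure_of U \<subseteq> topspace Y - {e z}"
          using regular_open_neighbourhood[OF reg, of "topspace Y - {e z}" "e x"] eX[OF x] by auto
        moreover from this have "U \<subseteq> topspace Y - {e z}"
          using regular_openin_subset_closure[of Y U] by blast
        ultimately show False using z(2) by (auto simp: T_def preimage_map_def)
      qed
      then have "topspace X \<inter> \<Inter> (T x) = {x}"
        using x by (auto simp: T_def preimage_map_def)
      moreover have "T x \<subseteq> Pow (topspace X)" using sub by (auto simp: T_def)
      ultimately show ?thesis by (simp add: powerset_inf)
    qed
    have "{\<Sqinter>\<^bsub>powerset_algebra X\<^esub> t | t. t \<in> T ` b} = (\<lambda>x. {x}) ` b"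
      using inf b by (auto simp: image_iff)
    then have "b = \<Squnion>\<^bsub>powerset_algebra X\<^esub> {\<Sqinter>\<^bsub>powerset_algebra X\<^esub> t | t. t \<in> T ` b}"
      using b by (subst powerset_sup) auto
    moreover have "\<forall>t \<in> T ` b. t \<subseteq> preimage_map X e ` carrier (regular_open_algebra Y)"
      by (auto simp: T_def)
    ultimately show "\<exists>\<T>. (\<forall>t\<in>\<T>. t \<subseteq> preimage_map X e ` carrier (regular_open_algebra Y)) \<and>
        b = \<Squnion>\<^bsub>powerset_algebra X\<^esub> {\<Sqinter>\<^bsub>powerset_algebra X\<^esub> t | t. t \<in> \<T>}"
      by blast
  qed
qed

end

theory Submission
  imports Defs
begin

text \<open>
  Traces on \<open>X\<close> identify the regular open sets of any compactification with those of \<open>X\<close>, so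
  all the extensions \<open>e\<^sup>-\<^sup>1\<close> are compatible, and a compatible extension \<open>C\<close> amounts to another proximity
  on the regular open sets of \<open>X\<close>. By interpolation, related elements of \<open>C\<close> are separated by a
  continuous \<open>X \<rightarrow> [0,1]\<close>. If \<open>e\<close> is equivalent to \<open>s\<close> this function extends to \<open>Y\<close>, so the
  proximity of \<open>Y\<close> contains that of \<open>C\<close> and the identification is itself a de Vries morphism. Conversely, maximality gives
  a de Vries morphism from the regular open sets of \<open>\<beta>X\<close> to those of \<open>Y\<close>; it controls cluster
  points well enough for \<open>s\<close> to have a limit at every point of \<open>Y\<close>, hence to extend over \<open>Y\<close>.
\<close>

section \<open>Traces of open sets on a dense subspace\<close>

lemma compactification_facts:
  assumes "compactification X Y e"
  shows "compact_space Y" "Hausdorff_space Y" "regular_space Y" "embedding_map X Y e"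
    "Y closure_of (e ` topspace X) = topspace Y" "continuous_map X Y e"
proof -
  show *: "compact_space Y" "Hausdorff_space Y" "embedding_map X Y e"
    "Y closure_of (e ` topspace X) = topspace Y"
    using assms by (auto simp: compactification_def)
  then show "regular_space Y" by (blast intro: compact_Hausdorff_imp_regular_space)
  have hom: "homeomorphic_map X (subtopology Y (e ` topspace X)) e"
    using *(3) by (simp add: embedding_map_def)
  show "continuous_map X Y e"
    using homeomorphic_imp_continuous_map[OF hom] by (simp add: continuous_map_in_subtopology)
qed

lemma preimage_map_openin:
  assumes "continuous_map X Y e" "openin Y U"
  shows "openin X (preimage_map X e U)"
  using openin_continuous_map_preimage[OF assms] by (simp add: preimage_map_def)

lemma embedding_map_open_trace:
  assumes "embedding_map X Y e" "openin X V"
  obtains U where "openin Y U" "preimage_map X e U = V"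
proof -
  let ?S = "subtopology Y (e ` topspace X)"
  have hom: "homeomorphic_map X ?S e" using assms(1) by (simp add: embedding_map_def)
  have "openin ?S (e ` V)"
    using homeomorphic_imp_open_map[OF hom] assms(2) by (simp add: open_map_def)
  then obtain U where U: "openin Y U" "e ` V = U \<inter> e ` topspace X"
    by (auto simp: openin_subtopology)
  have "x \<in> V" if "x \<in> topspace X" "e x \<in> e ` V" for x
    using that homeomorphic_imp_injective_map[OF hom] openin_subset[OF assms(2)]
    by (auto dest: inj_onD)
  then have "preimage_map X e U = V"
    using U(2) openin_subset[OF assms(2)] by (auto simp: preimage_map_def)
  with U(1) show thesis by (rule that)
qed

text \<open>Density makes the closure of \<open>U\<close> equal to the closure of those points of
  \<open>U\<close> that come from \<open>X\<close>, and these lie in \<open>V\<close>.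
  \<open>V\<close> is arbitrary because closures are also substituted for it below.\<close>

lemma compactification_trace_subset_closure:
  assumes "compactification X Y e" "openin Y U" "preimage_map X e U \<subseteq> preimage_map X e V"
  shows "U \<subseteq> Y closure_of V"
proof -
  have "U \<subseteq> Y closure_of (e ` topspace X)"
    using compactification_facts(5)[OF assms(1)] openin_subset[OF assms(2)] by simp
  then have "Y closure_of (U \<inter> e ` topspace X) = Y closure_of U"
    using closure_of_openin_Int_superset assms(2) by metis
  moreover have "U \<inter> e ` topspace X \<subseteq> V" using assms(3) by (auto simp: preimage_map_def)
  ultimately show ?thesis
    using closure_of_mono[of "U \<inter> e ` topspace X" V Y] closure_of_subset[OF openin_subset[OF assms(2)]]
    by auto
qed

text \<open>An open set inside the closure of \<open>V\<close> lies inside the interior of that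
  closure, which is \<open>V\<close>. Regular open sets of \<open>Y\<close> can thus be compared on
  the points of \<open>X\<close> alone.\<close>

lemma compactification_trace_subset:
  assumes "compactification X Y e" "openin Y U" "regular_openin Y V"
    "preimage_map X e U \<subseteq> preimage_map X e V"
  shows "U \<subseteq> V"
  using compactification_trace_subset_closure[OF assms(1,2,4)] assms(2,3)
    interior_of_maximal[of U "Y closure_of V" Y]
  by (simp add: regular_openin_def)

text \<open>The image depends only on \<open>X\<close>, which makes the extensions of any two
  compactifications compatible. For surjectivity, an open set with the given trace is replaced by
  the interior of its closure, which has the same trace.\<close>

lemma regular_openin_preimage_map:
  assumes "compactification X Y e"
  shows "preimage_map X e ` carrier (regular_open_algebra Y) = {V. regular_openin X V}"
proof -
  note f = compactification_facts[OF assms]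
  have "regular_openin X (preimage_map X e U)" if U: "regular_openin Y U" for U
  proof -
    let ?W = "preimage_map X e U"
    have oW: "openin X ?W" by (rule preimage_map_openin[OF f(6) regular_openin_openin[OF U]])
    \<comment> \<open>\<open>O'\<close> extends the interior of the closure of the trace to
      \<open>Y\<close>. Continuity bounds its trace by the closure of \<open>U\<close>, density then
      bounds \<open>O'\<close> itself, and regularity of \<open>U\<close> puts \<open>O'\<close>
      inside \<open>U\<close>.\<close>
    obtain O' where O': "openin Y O'" "preimage_map X e O' = X interior_of (X closure_of ?W)"
      using embedding_map_open_trace[OF f(4)] openin_interior_of by metis
    have "e ` (X closure_of ?W) \<subseteq> Y closure_of (e ` ?W)"
      by (rule continuous_map_image_closure_subset[OF f(6)])
    also have "\<dots> \<subseteq> Y closure_of U" by (rule closure_of_mono) (auto simp: preimage_map_def)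
    finally have "preimage_map X e O' \<subseteq> preimage_map X e (Y closure_of U)"
      using O'(2) interior_of_subset[of X "X closure_of ?W"] by (auto simp: preimage_map_def)
    then have "O' \<subseteq> Y closure_of U"
      using compactification_trace_subset_closure[OF assms O'(1)] closure_of_closure_of by metis
    then have "O' \<subseteq> U"
      using U O'(1) interior_of_maximal unfolding regular_openin_def by metis
    then have "X interior_of (X closure_of ?W) \<subseteq> ?W"
      using O'(2) by (auto simp: preimage_map_def)
    then show ?thesis
      unfolding regular_openin_def
      using interior_closure_increasing[OF oW] by (rule subset_antisym)
  qed
  moreover have "V \<in> preimage_map X e ` {U. regular_openin Y U}" if V: "regular_openin X V" for V
  proof -
    obtain U where U: "openin Y U" "preimage_map X e U = V"
      using embedding_map_open_trace[OF f(4) regular_openin_openin[OF V]] by blast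
    let ?R = "Y interior_of (Y closure_of U)"
    have "preimage_map X e ?R \<subseteq> X closure_of V"
    proof
      fix x assume x: "x \<in> preimage_map X e ?R"
      show "x \<in> X closure_of V"
        unfolding in_closure_of
      proof (intro conjI allI impI)
        show "x \<in> topspace X" using x by (simp add: preimage_map_def)
        fix T assume T: "x \<in> T \<and> openin X T"
        then obtain O' where O': "openin Y O'" "preimage_map X e O' = T"
          using embedding_map_open_trace[OF f(4)] by metis
        have "e x \<in> Y closure_of U" "e x \<in> O'"
          using x O' T interior_of_subset[of Y "Y closure_of U"] by (auto simp: preimage_map_def)
        \<comment> \<open>A neighbourhood \<open>O'\<close> of \<open>e x\<close> meets
          \<open>U\<close> in a nonempty open set, which by density contains the image of a point of
          \<open>X\<close>.\<close>
        then have "O' \<inter> U \<noteq> {}" using O'(1) by (auto simp: in_closure_of)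
        then have "e ` topspace X \<inter> (O' \<inter> U) \<noteq> {}"
          using f(5) O'(1) U(1) openin_Int dense_intersects_open by metis
        then show "\<exists>y. y \<in> V \<and> y \<in> T" using O'(2) U(2) by (auto simp: preimage_map_def)
      qed
    qed
    then have "preimage_map X e ?R \<subseteq> V"
      using V preimage_map_openin[OF f(6), of ?R] interior_of_maximal
      unfolding regular_openin_def by (metis openin_interior_of)
    moreover have "V \<subseteq> preimage_map X e ?R"
      using U interior_closure_increasing[OF U(1)] by (auto simp: preimage_map_def)
    ultimately have "V = preimage_map X e ?R" by blast
    then show ?thesis by (intro image_eqI[of _ _ ?R]) auto
  qed
  ultimately show ?thesis by auto
qed

lemma compatible_compactifications:
  assumes "compactification X Y e" "compactification X Z s"
  shows "compatible (regular_open_algebra Y) (preimage_map X e)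
    (regular_open_algebra Z) (preimage_map X s)"
  using assms by (simp only: compatible_def regular_openin_preimage_map)


section \<open>Extension of maps to the Stone--Cech compactification\<close>

text \<open>\<open>stone_cech\<close> only says that \<open>s\<close> is largest. The universal
  property follows because the points \<open>(s x, f x)\<close> embed \<open>X\<close> in the
  product of \<open>Z\<close> and \<open>K\<close>: their closure \<open>W\<close> is a
  compactification of \<open>X\<close>, and the second coordinate of the comparison map from
  \<open>Z\<close> to \<open>W\<close> extends \<open>f\<close>.\<close>

lemma stone_cech_extension:
  fixes K :: "'k topology"
  assumes s: "stone_cech X Z s" and K: "compact_space K" "Hausdorff_space K"
    and f: "continuous_map X K f"
  obtains F where "continuous_map Z K F" "\<And>x. x \<in> topspace X \<Longrightarrow> F (s x) = f x"
proof -
  have c: "compactification X Z s" using s by (simp add: stone_cech_def)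
  note c' = compactification_facts[OF c]
  define p where "p x = (s x, f x)" for x
  let ?P = "prod_topology Z K"
  define W where "W = subtopology ?P (?P closure_of (p ` topspace X))"
  have p: "continuous_map X ?P p"
    unfolding p_def using c'(6) f by (simp add: continuous_map_pairedI)
  have sub: "p ` topspace X \<subseteq> topspace ?P" using continuous_map_image_subset_topspace[OF p] .
  obtain k where k: "homeomorphic_maps X (subtopology Z (s ` topspace X)) s k"
    using c'(4) unfolding embedding_map_def homeomorphic_map_maps by blast
  \<comment> \<open>The inverse of \<open>p\<close> forgets the second coordinate and then inverts
    \<open>s\<close>.\<close>
  have "homeomorphic_maps X (subtopology ?P (p ` topspace X)) p (k \<circ> fst)"
    unfolding homeomorphic_maps_def
  proof (intro conjI ballI)
    show "continuous_map X (subtopology ?P (p ` topspace X)) p"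
      using p by (simp add: continuous_map_in_subtopology)
    have "continuous_map (subtopology ?P (p ` topspace X)) (subtopology Z (s ` topspace X)) fst"
      unfolding continuous_map_in_subtopology
      by (auto simp: p_def continuous_map_fst continuous_map_from_subtopology)
    then show "continuous_map (subtopology ?P (p ` topspace X)) X (k \<circ> fst)"
      using k continuous_map_compose unfolding homeomorphic_maps_def by blast
  qed (use k in \<open>auto simp: p_def homeomorphic_maps_def\<close>)
  then have "embedding_map X ?P p"
    unfolding embedding_map_def homeomorphic_map_maps by blast
  then have "embedding_map X W p"
    unfolding W_def embedding_map_in_subtopology using closure_of_subset[OF sub] by blast
  moreover have "compact_space W"
    unfolding W_def using c'(1) K(1)
    by (intro closedin_compact_space compact_space_subtopology)
      (auto simp: compact_space_prod_topology)
  moreover have "Hausdorff_space W"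
    unfolding W_def using c'(2) K(2)
    by (intro Hausdorff_space_subtopology) (simp add: Hausdorff_space_prod_topology)
  moreover have "W closure_of (p ` topspace X) = topspace W"
    unfolding W_def topspace_subtopology
    using closure_of_subset[OF sub] closure_of_subset_topspace[of ?P "p ` topspace X"]
    by (simp only: closure_of_subtopology Int_absorb1 Int_absorb2)
  ultimately have "compactification X W p"
    using c by (simp add: compactification_def)
  from stone_cech_largest[OF s this] obtain g where
    g: "continuous_map Z W g" "\<And>x. x \<in> topspace X \<Longrightarrow> g (s x) = p x"
    unfolding compactification_le_def by blast
  show thesis
  proof
    have "continuous_map Z ?P g" using g(1) unfolding W_def by (simp add: continuous_map_in_subtopology)
    then show "continuous_map Z K (snd \<circ> g)" using continuous_map_snd continuous_map_compose by blast
  qed (simp add: g p_def)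
qed

section \<open>Urysohn functions from an interpolating relation\<close>

lemma dyadics_dense:
  fixes c d :: real
  assumes "0 \<le> c" "c < d" "d \<le> 1"
  shows "\<exists>r\<in>dyadics \<inter> {0..1}. c < r \<and> r < d"
proof -
  have "0 < d - c" "(1::real) < 2" using assms by auto
  then obtain n q r where
    "of_nat q / 2^n \<le> c" "c < of_nat r / 2^n" "\<bar>real q / 2^n - real r / 2^n \<bar> < d - c"
    using assms(1) by (rule padic_rational_approximation_straddle_pos_le)
  then have "c < real r / 2^n" "real r / 2^n < d" by linarith+
  moreover from this have "real r / 2^n \<in> {0..1}"
    using assms unfolding atLeastAtMost_iff by linarith
  moreover have "real r / 2^n \<in> dyadics" by (auto simp: dyadics_def)
  ultimately show ?thesis by blast
qed

text \<open>The construction is that of Urysohn's lemma, with the intermediate sets supplied by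
  interpolation of \<open>R\<close> in place of normality of \<open>X\<close>.\<close>

lemma interpolating_relation_separation:
  assumes RST: "R S T"
    and interpol: "\<And>U V. R U V \<Longrightarrow> \<exists>W. R U W \<and> R W V"
    and trans: "\<And>U V W. \<lbrakk>R U V; R V W\<rbrakk> \<Longrightarrow> R U W"
    and sep: "\<And>U V. R U V \<Longrightarrow> openin X U \<and> openin X V \<and> X closure_of U \<subseteq> V"
  shows "\<exists>f. continuous_map X (top_of_set {0..1::real}) f \<and>
    (\<forall>x\<in>S. f x = 0) \<and> (\<forall>x\<in>topspace X - T. f x = 1)"
proof -
  have "\<exists>G :: real \<Rightarrow> 'a set. G 0 = S \<and> G 1 = T \<and>
      (\<forall>x\<in>dyadics \<inter> {0..1}. \<forall>y\<in>dyadics \<inter> {0..1}. x < y \<longrightarrow> R (G x) (G y))"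
    by (rule recursion_on_dyadic_fractions[of R]) (fact RST interpol trans)+
  then obtain G :: "real \<Rightarrow> 'a set" where G01: "G 0 = S" "G 1 = T"
    and G: "\<And>x y. \<lbrakk>x \<in> dyadics \<inter> {0..1}; y \<in> dyadics \<inter> {0..1}; x < y\<rbrakk> \<Longrightarrow> R (G x) (G y)"
    by blast
  let ?D = "dyadics \<inter> {0..1::real}"
  have D: "0 \<in> ?D" "1 \<in> ?D" by (force simp: dyadics_def)+
  \<comment> \<open>The index 1 is separate because \<open>G\<close> relates only strictly
    increasing indices.\<close>
  have opn: "openin X (G r)" if "r \<in> ?D" for r
    using sep[OF G[OF that D(2)]] sep[OF RST] G01 that by (cases "r = 1") auto
  have cl: "X closure_of (G r) \<subseteq> G r'" if "r \<in> ?D" "r' \<in> ?D" "r < r'" for r r'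
    using sep[OF G[OF that]] by blast
  have mono: "G r \<subseteq> G r'" if "r \<in> ?D" "r' \<in> ?D" "r < r'" for r r'
    using cl[OF that] closure_of_subset[OF openin_subset[OF opn[OF that(1)]]] by blast
  \<comment> \<open>The extra 1 gives the value at points in no \<open>G r\<close> and keeps the set
    nonempty.\<close>
  define f where "f x = Inf (insert 1 {r \<in> ?D. x \<in> G r})" for x
  have bdd: "bdd_below (insert 1 {r \<in> ?D. x \<in> G r})" for x
    by (rule bdd_belowI[of _ 0]) auto
  have f0: "0 \<le> f x" for x unfolding f_def by (rule cInf_greatest) auto
  have f1: "f x \<le> 1" for x unfolding f_def using bdd by (rule cInf_lower[rotated]) simp
  have fle: "f x \<le> r" if "r \<in> ?D" "x \<in> G r" for x r
    unfolding f_def using bdd by (rule cInf_lower[rotated]) (use that in simp)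
  have fge: "r \<le> f x" if r: "r \<in> ?D" "x \<notin> G r" for x r
    unfolding f_def
  proof (rule cInf_greatest)
    fix q assume "q \<in> insert 1 {r \<in> ?D. x \<in> G r}"
    then show "r \<le> q" using r mono[of q r] by (cases "q < r") auto
  qed simp
  show ?thesis
  proof (intro exI conjI ballI)
    show "f x = 0" if "x \<in> S" for x
      using fle[OF D(1)] G01 that f0[of x] by (simp add: order_antisym)
    show "f x = 1" if "x \<in> topspace X - T" for x
      using fge[OF D(2)] G01 that f1[of x] by (simp add: order_antisym)
    show "continuous_map X (top_of_set {0..1}) f"
      unfolding continuous_map_upper_lower_semicontinuous_lt_gen
    proof (intro conjI allI ballI)
      fix a :: real
      \<comment> \<open>Two indices are placed between \<open>a\<close> and \<open>f x\<close>:
        \<open>x\<close> lies outside \<open>G r'\<close>, hence outside the closure of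
        \<open>G r\<close>. This writes the superlevel set as a union of complements of closed
        sets.\<close>
      have "\<exists>r \<in> ?D. a < r \<and> x \<notin> X closure_of (G r)" if a: "0 \<le> a" "a < f x" for x
      proof -
        obtain r' where r': "r' \<in> ?D" "a < r'" "r' < f x"
          using dyadics_dense[OF a f1] by blast
        moreover obtain r where r: "r \<in> ?D" "a < r" "r < r'"
          using dyadics_dense[of a r'] a r' by fastforce
        ultimately show ?thesis using cl[OF r(1) r'(1) r(3)] fle[OF r'(1), of x] by force
      qed
      moreover have "a < f x" if "r \<in> ?D" "a < r" "x \<in> topspace X" "x \<notin> X closure_of (G r)" for r x
        using that fge[OF that(1), of x] closure_of_subset[OF openin_subset[OF opn[OF that(1)]]]
        by force
      ultimately have "{x \<in> topspace X. a < f x} =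
          (\<Union>r \<in> {r \<in> ?D. a < r}. topspace X - X closure_of (G r))" if "0 \<le> a"
        using that by blast
      moreover have "{x \<in> topspace X. a < f x} = topspace X" if "\<not> 0 \<le> a"
        using that less_le_trans[OF _ f0, of a] by auto
      moreover have "openin X (\<Union>r \<in> {r \<in> ?D. a < r}. topspace X - X closure_of (G r))"
        by (intro openin_clauses(3)) auto
      ultimately show "openin X {x \<in> topspace X. a < f x}"
        by (metis openin_topspace)
      have "\<exists>r \<in> ?D. r < a \<and> x \<in> G r" if a: "a \<le> 1" "f x < a" for x
      proof -
        obtain r where "r \<in> ?D" "f x < r" "r < a"
          using dyadics_dense[OF f0 a(2,1)] by blast
        then show ?thesis using fge[of r x] by force
      qed
      moreover have "f x < a" if "r \<in> ?D" "r < a" "x \<in> G r" for r x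
        using that fle[OF that(1), of x] by force
      moreover have "x \<in> topspace X" if "r \<in> ?D" "x \<in> G r" for r x
        using that openin_subset[OF opn] by blast
      ultimately have "{x \<in> topspace X. f x < a} = (\<Union>r \<in> {r \<in> ?D. r < a}. G r)" if "a \<le> 1"
        using that by blast
      moreover have "{x \<in> topspace X. f x < a} = topspace X" if "\<not> a \<le> 1"
        using that le_less_trans[OF f1, of a] by auto
      moreover have "openin X (\<Union>r \<in> {r \<in> ?D. r < a}. G r)"
        using opn by (intro openin_clauses(3)) auto
      ultimately show "openin X {x \<in> topspace X. f x < a}"
        by (metis openin_topspace)
    qed (use f0 f1 in auto)
  qed
qed


section \<open>Maximality of the Stone--Cech extension\<close>

lemma (in de_vries_morphism) complement_disjoint:
  assumes "a \<in> carrier A"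
  shows "\<rho> a \<sqinter>\<^bsub>B\<^esub> \<rho> (\<sim>\<^bsub>A\<^esub> a) = \<bottom>\<^bsub>B\<^esub>"
  using assms M2[of a "\<sim>\<^bsub>A\<^esub> a"] M1 by (simp add: source.complement)

lemma (in de_vries_morphism) mono:
  assumes "a \<in> carrier A" "b \<in> carrier A" "a \<sqsubseteq>\<^bsub>A\<^esub> b"
  shows "\<rho> a \<sqsubseteq>\<^bsub>B\<^esub> \<rho> b"
proof -
  have "\<rho> a = \<rho> a \<sqinter>\<^bsub>B\<^esub> \<rho> b"
    using assms M2[of a b] source.le_iff_join[of a b] by simp
  moreover have "\<rho> a \<in> carrier B" "\<rho> b \<in> carrier B" using assms closed by auto
  ultimately show ?thesis using target.le_iff_join by metis
qed

lemma (in de_vries_algebra) prox_trans: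
  assumes "a \<in> carrier A" "b \<in> carrier A" "c \<in> carrier A" "a \<lless> b" "b \<lless> c"
  shows "a \<lless> c"
  using DV3[of a b c c] DV2[of a b] assms by simp

text \<open>Interpolation in \<open>C\<close> yields a function on \<open>X\<close> that is 0 on
  \<open>\<gamma> a\<close> and 1 off \<open>\<gamma> b\<close>. It extends to \<open>Z\<close> and,
  through the comparison map, to a function \<open>H\<close> on \<open>Y\<close>. By density
  \<open>H\<close> vanishes on the closure of \<open>U\<close> and is below 1 only inside
  \<open>V\<close>.\<close>

lemma prox_imp_closure_subset:
  assumes c: "compactification X Y e" and s: "stone_cech X Z s"
    and le: "compactification_le X Z s Y e"
    and \<gamma>: "de_vries_extension C (powerset_algebra X) \<gamma>"
    and opn: "\<And>c. c \<in> carrier C \<Longrightarrow> openin X (\<gamma> c)"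
    and ab: "a \<in> carrier C" "b \<in> carrier C" "a \<lless>\<^bsub>C\<^esub> b"
    and U: "openin Y U" "preimage_map X e U = \<gamma> a"
    and V: "regular_openin Y V" "preimage_map X e V = \<gamma> b"
  shows "Y closure_of U \<subseteq> V"
proof -
  interpret C: de_vries_extension C "powerset_algebra X" \<gamma> by (rule \<gamma>)
  have sub: "\<gamma> c \<subseteq> topspace X" if "c \<in> carrier C" for c
    using opn[OF that] by (rule openin_subset)
  \<comment> \<open>The image of the complement of \<open>c\<close> is open and disjoint from
    \<open>\<gamma> c\<close>, hence from its closure; \<open>M3\<close> puts all points outside
    this image into \<open>\<gamma> d\<close>.\<close>
  have cl: "X closure_of (\<gamma> c) \<subseteq> \<gamma> d" if "c \<in> carrier C" "d \<in> carrier C" "c \<lless>\<^bsub>C\<^esub> d" for c d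
  proof -
    have n: "\<sim>\<^bsub>C\<^esub> c \<in> carrier C" using that by (simp add: C.source.complement)
    have "\<gamma> c \<inter> \<gamma> (\<sim>\<^bsub>C\<^esub> c) = {}"
      using C.complement_disjoint[OF that(1)] sub[OF that(1)] sub[OF n]
      by (simp add: powerset_ops)
    then have "X closure_of (\<gamma> c) \<subseteq> topspace X - \<gamma> (\<sim>\<^bsub>C\<^esub> c)"
      using sub[OF that(1)] opn[OF n] by (intro closure_of_minimal) auto
    also have "\<dots> \<subseteq> \<gamma> d"
      using C.M3[OF that] sub[OF n] by (simp add: powerset_complement)
    finally show ?thesis .
  qed
  define R where "R S T \<longleftrightarrow> (\<exists>c\<in>carrier C. \<exists>d\<in>carrier C. S = \<gamma> c \<and> T = \<gamma> d \<and> c \<lless>\<^bsub>C\<^esub> d)" for S T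
  \<comment> \<open>Injectivity makes \<open>R\<close> transitive: the middle set of two related
    pairs comes from a single element of \<open>C\<close>.\<close>
  have inj: "c = d" if "\<gamma> c = \<gamma> d" "c \<in> carrier C" "d \<in> carrier C" for c d
    using that C.inj by (auto dest: inj_onD)
  have R: "R (\<gamma> a) (\<gamma> b)" using ab by (auto simp: R_def)
  have R_interpol: "\<exists>W. R S W \<and> R W T" if "R S T" for S T
    using that C.source.DV6 unfolding R_def by metis
  have R_trans: "R S T" if "R S W" "R W T" for S W T
    using that inj C.source.prox_trans unfolding R_def by metis
  have R_sep: "openin X S \<and> openin X T \<and> X closure_of S \<subseteq> T" if "R S T" for S T
    using that opn cl unfolding R_def by blast
  have "\<exists>f. continuous_map X (top_of_set {0..1::real}) f \<and>
      (\<forall>x\<in>\<gamma> a. f x = 0) \<and> (\<forall>x\<in>topspace X - \<gamma> b. f x = 1)"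
    by (rule interpolating_relation_separation[of R]) (fact R R_interpol R_trans R_sep)+
  then obtain f where f: "continuous_map X (top_of_set {0..1::real}) f"
    "\<And>x. x \<in> \<gamma> a \<Longrightarrow> f x = 0" "\<And>x. x \<in> topspace X - \<gamma> b \<Longrightarrow> f x = 1"
    by blast
  obtain F where F: "continuous_map Z (top_of_set {0..1::real}) F"
    "\<And>x. x \<in> topspace X \<Longrightarrow> F (s x) = f x"
    using stone_cech_extension[OF s _ _ f(1)]
    by (metis compact_Icc compact_space_subtopology compactin_euclidean_iff
        Hausdorff_space_euclidean Hausdorff_space_subtopology)
  obtain g where g: "continuous_map Y Z g" "\<And>x. x \<in> topspace X \<Longrightarrow> g (e x) = s x"
    using le unfolding compactification_le_def by blast
  define H where "H = F \<circ> g"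
  have H: "continuous_map Y euclideanreal H"
    using continuous_map_compose[OF g(1) F(1)] by (simp add: H_def continuous_map_in_subtopology)
  have He: "H (e x) = f x" if "x \<in> topspace X" for x
    using that by (simp add: H_def g F)
  have "openin Y {y \<in> topspace Y. H y \<in> {..<1}}" "openin Y {y \<in> topspace Y. H y \<in> {0<..} \<union> {..<0}}"
    by (rule openin_continuous_map_preimage[OF H]; auto simp flip: open_openin)+
  then have o: "openin Y {y \<in> topspace Y. H y < 1}" and
    o0: "openin Y {y \<in> topspace Y. H y \<in> {0<..} \<union> {..<0}}" by simp_all
  \<comment> \<open>The open set where \<open>H\<close> is nonzero has no trace in \<open>U\<close>.
    Density makes it disjoint from \<open>U\<close>, and openness makes it disjoint from the closure
    of \<open>U\<close>.\<close>
  have "preimage_map X e ({y \<in> topspace Y. H y \<in> {0<..} \<union> {..<0}} \<inter> U) \<subseteq> preimage_map X e {}"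
  proof
    fix x assume "x \<in> preimage_map X e ({y \<in> topspace Y. H y \<in> {0<..} \<union> {..<0}} \<inter> U)"
    then have "x \<in> topspace X" "x \<in> preimage_map X e U" "H (e x) \<noteq> 0"
      by (auto simp: preimage_map_def)
    then show "x \<in> preimage_map X e {}" using f(2) U(2) He by auto
  qed
  then have "{y \<in> topspace Y. H y \<in> {0<..} \<union> {..<0}} \<inter> U \<subseteq> {}"
    by (rule compactification_trace_subset[OF c openin_Int[OF o0 U(1)] regular_openin_empty])
  then have "{y \<in> topspace Y. H y \<in> {0<..} \<union> {..<0}} \<inter> Y closure_of U = {}"
    using openin_Int_closure_of_eq_empty[OF o0, of U] by blast
  then have "Y closure_of U \<subseteq> {y \<in> topspace Y. H y < 1}"
    using closure_of_subset_topspace[of Y U] by (force simp: not_less)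
  also have "\<dots> \<subseteq> V"
  proof (rule compactification_trace_subset[OF c o V(1)])
    show "preimage_map X e {y \<in> topspace Y. H y < 1} \<subseteq> preimage_map X e V"
      unfolding V(2) using f(3) He by (force simp: preimage_map_def)
  qed
  finally show ?thesis .
qed

text \<open>Each \<open>\<gamma> c\<close> is the trace of a regular open set \<open>h c\<close> of
  \<open>Y\<close>, and \<open>h\<close> is the required morphism: proximity in \<open>C\<close>
  passes to \<open>Y\<close> by \<open>prox_imp_closure_subset\<close>, and inclusions are checked
  on traces. Of the equivalence only \<open>s\<close> below \<open>e\<close> is assumed, since
  \<open>s\<close> is above every compactification.\<close>

lemma maximal_extension_if_equiv:
  assumes c: "compactification X Y e" and s: "stone_cech X Z s"
    and le: "compactification_le X Z s Y e"
  shows "maximal_extension (regular_open_algebra Y) (powerset_algebra X) (preimage_map X e)"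
  unfolding maximal_extension_def
proof (intro conjI allI impI)
  let ?R = "regular_open_algebra Y" and ?P = "powerset_algebra X"
  show "de_vries_extension ?R ?P (preimage_map X e)"
    by (rule de_vries_extension_compactification[OF c])
  fix C :: "'b set proximity_order" and \<gamma>
  assume "de_vries_extension C ?P \<gamma> \<and> compatible ?R (preimage_map X e) C \<gamma>"
  then have \<gamma>: "de_vries_extension C ?P \<gamma>"
    and img: "preimage_map X e ` {U. regular_openin Y U} = \<gamma> ` carrier C"
    by (auto simp: compatible_def)
  note f = compactification_facts[OF c]
  interpret C: de_vries_extension C ?P \<gamma> by (rule \<gamma>)
  interpret R: de_vries_algebra ?R by (rule de_vries_algebra_regular_open[OF f(1,2)])
  have "\<forall>c\<in>carrier C. \<exists>U. regular_openin Y U \<and> preimage_map X e U = \<gamma> c"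
    using img by (metis (mono_tags, lifting) imageE imageI mem_Collect_eq)
  then obtain h where h: "\<And>c. c \<in> carrier C \<Longrightarrow> regular_openin Y (h c)"
      "\<And>c. c \<in> carrier C \<Longrightarrow> preimage_map X e (h c) = \<gamma> c"
    by metis
  have ho: "openin Y (h c)" if "c \<in> carrier C" for c using h(1)[OF that] by (rule regular_openin_openin)
  have opn: "openin X (\<gamma> c)" if "c \<in> carrier C" for c
    using preimage_map_openin[OF f(6) ho[OF that]] h(2)[OF that] by simp
  have sub: "\<gamma> c \<subseteq> topspace X" if "c \<in> carrier C" for c
    using opn[OF that] by (rule openin_subset)
  have hle: "h a \<subseteq> h b" if "a \<in> carrier C" "b \<in> carrier C" "a \<sqsubseteq>\<^bsub>C\<^esub> b" for a b
    using compactification_trace_subset[OF c ho[OF that(1)] h(1)[OF that(2)]] h(2) that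
      C.mono[OF that] by simp
  have hprox: "Y closure_of (h a) \<subseteq> h b" if "a \<in> carrier C" "b \<in> carrier C" "a \<lless>\<^bsub>C\<^esub> b" for a b
    using prox_imp_closure_subset[OF c s le \<gamma> opn that ho h(2) h(1) h(2)] that by blast
  have sup: "\<gamma> b = \<Union>{\<gamma> a | a. a \<in> carrier C \<and> a \<lless>\<^bsub>C\<^esub> b}" if "b \<in> carrier C" for b
    using C.M4[OF that] sub powerset_sup[of "{\<gamma> a | a. a \<in> carrier C \<and> a \<lless>\<^bsub>C\<^esub> b}" X] by auto
  have "de_vries_morphism C ?R h"
  proof unfold_locales
    show "h \<in> carrier C \<rightarrow> carrier ?R" using h by auto
    show "h \<bottom>\<^bsub>C\<^esub> = \<bottom>\<^bsub>?R\<^esub>"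
      using compactification_trace_subset[OF c ho regular_openin_empty, of "\<bottom>\<^bsub>C\<^esub>"] h(2)[of "\<bottom>\<^bsub>C\<^esub>"] C.M1
      by (simp add: regular_open_ops powerset_ops)
  next
    fix a b assume a: "a \<in> carrier C" and b: "b \<in> carrier C"
    have ab: "a \<sqinter>\<^bsub>C\<^esub> b \<in> carrier C" using a b by simp
    have eq: "preimage_map X e (h (a \<sqinter>\<^bsub>C\<^esub> b)) = preimage_map X e (h a \<inter> h b)"
      using h(2)[OF ab] h(2)[OF a] h(2)[OF b] C.M2[OF a b] sub[OF a] sub[OF b]
      by (auto simp: powerset_ops preimage_map_def)
    have "h (a \<sqinter>\<^bsub>C\<^esub> b) = h a \<inter> h b"
      using eq h(1)[OF a] h(1)[OF b] h(1)[OF ab] ho[OF a] ho[OF b] ho[OF ab]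
      by (intro subset_antisym compactification_trace_subset[OF c])
        (auto intro: regular_openin_Int)
    then show "h (a \<sqinter>\<^bsub>C\<^esub> b) = h a \<sqinter>\<^bsub>?R\<^esub> h b"
      using h(1)[OF a] h(1)[OF b] by (simp add: regular_open_ops)
    assume "a \<lless>\<^bsub>C\<^esub> b"
    \<comment> \<open>\<open>M3\<close> for \<open>\<gamma>\<close> gives only an inclusion, since
      proximity in the power set is inclusion. It places the complement in \<open>h d\<close>; the
      step from \<open>d\<close> to \<open>b\<close> then places its closure in
      \<open>h b\<close>.\<close>
    then obtain d where d: "d \<in> carrier C" "a \<lless>\<^bsub>C\<^esub> d" "d \<lless>\<^bsub>C\<^esub> b"
      using C.source.DV6[OF a b] by blast
    have n: "\<sim>\<^bsub>C\<^esub> a \<in> carrier C" using a by (simp add: C.source.complement)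
    have "preimage_map X e (topspace Y - Y closure_of h (\<sim>\<^bsub>C\<^esub> a)) \<subseteq> topspace X - \<gamma> (\<sim>\<^bsub>C\<^esub> a)"
      using h(2)[OF n] regular_openin_subset_closure[OF h(1)[OF n]] by (auto simp: preimage_map_def)
    also have "\<dots> \<subseteq> preimage_map X e (h d)"
      using C.M3[OF a d(1,2)] sub[OF n] h(2)[OF d(1)] by (simp add: powerset_complement)
    finally have "topspace Y - Y closure_of h (\<sim>\<^bsub>C\<^esub> a) \<subseteq> h d"
      by (intro compactification_trace_subset[OF c _ h(1)[OF d(1)]]) (auto intro: openin_diff)
    then have "Y closure_of (topspace Y - Y closure_of h (\<sim>\<^bsub>C\<^esub> a)) \<subseteq> h b"
      using hprox[OF d(1) b d(3)] closure_of_mono by blast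
    then show "\<sim>\<^bsub>?R\<^esub> h (\<sim>\<^bsub>C\<^esub> a) \<lless>\<^bsub>?R\<^esub> h b"
      by (simp add: regular_open_complement[OF h(1)[OF n]])
  next
    fix b assume b: "b \<in> carrier C"
    let ?S = "{h a | a. a \<in> carrier C \<and> a \<lless>\<^bsub>C\<^esub> b}"
    have S: "?S \<subseteq> carrier ?R" using h by auto
    have "preimage_map X e (h b) \<subseteq> preimage_map X e (\<Union>?S)"
    proof
      fix x assume "x \<in> preimage_map X e (h b)"
      then obtain a where "a \<in> carrier C" "a \<lless>\<^bsub>C\<^esub> b" "x \<in> preimage_map X e (h a)"
        using sup[OF b] h(2) b by auto
      then show "x \<in> preimage_map X e (\<Union>?S)" by (auto simp: preimage_map_def)
    qed
    then have "h b \<subseteq> Y interior_of (Y closure_of \<Union>?S)"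
      by (intro interior_of_maximal[OF _ ho[OF b]] compactification_trace_subset_closure[OF c ho[OF b]])
    moreover have "Y interior_of (Y closure_of \<Union>?S) \<subseteq> h b"
      using hle[OF _ b] C.source.DV2[OF _ b] h(1)[OF b] by (intro interior_closure_least) blast+
    ultimately show "h b = \<Squnion>\<^bsub>?R\<^esub> ?S" using regular_open_sup[OF S] by blast
  qed
  moreover have "dv_compose C ?P (preimage_map X e) h c = \<gamma> c" if "c \<in> carrier C" for c
  proof -
    have "{preimage_map X e (h a) | a. a \<in> carrier C \<and> a \<lless>\<^bsub>C\<^esub> c} = {\<gamma> a | a. a \<in> carrier C \<and> a \<lless>\<^bsub>C\<^esub> c}"
      using h(2) by metis
    then show ?thesis using C.M4[OF that] by (simp add: dv_compose_def)
  qed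
  ultimately show "\<exists>\<delta>. de_vries_morphism C ?R \<delta> \<and>
      (\<forall>c\<in>carrier C. dv_compose C ?P (preimage_map X e) \<delta> c = \<gamma> c)"
    by blast
qed


section \<open>Continuous maps from de Vries morphisms\<close>

text \<open>With \<open>k\<close> inverse to \<open>e\<close>, the map \<open>s \<circ> k\<close> on
  the dense image of \<open>X\<close> has a limit at every point of \<open>Y\<close>; as
  \<open>Z\<close> is regular, it extends continuously. Compactness of \<open>Z\<close> supplies a
  candidate for the limit, and \<open>\<delta>\<close> shows that it is one.\<close>

lemma compactification_le_if_morphism:
  assumes c: "compactification X Y e" and cs: "compactification X Z s"
    and \<delta>: "de_vries_morphism (regular_open_algebra Z) (regular_open_algebra Y) \<delta>"
    and comp: "\<And>V. regular_openin Z V \<Longrightarrow>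
      dv_compose (regular_open_algebra Z) (powerset_algebra X) (preimage_map X e) \<delta> V = preimage_map X s V"
  shows "compactification_le X Z s Y e"
proof -
  note f = compactification_facts[OF c] and g = compactification_facts[OF cs]
  interpret D: de_vries_morphism "regular_open_algebra Z" "regular_open_algebra Y" \<delta> by (rule \<delta>)
  have \<delta>r: "regular_openin Y (\<delta> V)" if "regular_openin Z V" for V
    using funcset_mem[OF D.closed, of V] that by simp
  have comp': "preimage_map X s V =
      \<Union>{preimage_map X e (\<delta> U) | U. regular_openin Z U \<and> Z closure_of U \<subseteq> V}"
    if "regular_openin Z V" for V
    unfolding comp[OF that, symmetric] dv_compose_def
    by (subst powerset_sup) (auto simp: preimage_map_def)
  \<comment> \<open>Since \<open>dv_compose\<close> is a join over smaller sets, the trace of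
    \<open>\<delta> V\<close> is not given directly. It contains the trace of \<open>V\<close> by
    \<open>up\<close>, and by \<open>down\<close> it lies in the trace of any regular open set
    containing the closure of \<open>V\<close>.\<close>
  have up: "preimage_map X s V \<subseteq> preimage_map X e (\<delta> V)" if V: "regular_openin Z V" for V
  proof -
    have "\<delta> U \<subseteq> \<delta> V" if "regular_openin Z U" "Z closure_of U \<subseteq> V" for U
      using D.mono[of U V] that V regular_openin_subset_closure[of Z U] by auto
    then show ?thesis unfolding comp'[OF V] by (force simp: preimage_map_def)
  qed
  have down: "preimage_map X e (\<delta> U) \<subseteq> preimage_map X s V"
    if "regular_openin Z U" "regular_openin Z V" "Z closure_of U \<subseteq> V" for U V
    unfolding comp'[OF that(2)] using that by blast
  \<comment> \<open>\<open>\<delta> U\<close> is disjoint from the image of the complement of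
    \<open>U\<close>, so it lies in the regular open complement of that image, to which
    \<open>M3\<close> applies.\<close>
  have key: "Y closure_of (e ` preimage_map X s U) \<subseteq> \<delta> V"
    if U: "regular_openin Z U" and V: "regular_openin Z V" and UV: "Z closure_of U \<subseteq> V" for U V
  proof -
    let ?N = "topspace Z - Z closure_of U"
    have N: "regular_openin Z ?N" using U by (intro regular_open_compl regular_openin_openin)
    have "\<delta> U \<inter> \<delta> ?N = {}"
      using D.complement_disjoint[of U] U \<delta>r[OF U] \<delta>r[OF N]
      by (simp add: regular_open_complement regular_open_ops)
    then have "\<delta> U \<inter> Y closure_of (\<delta> ?N) = {}"
      using openin_Int_closure_of_eq_empty[OF regular_openin_openin[OF \<delta>r[OF U]]] by blast
    then have "\<delta> U \<subseteq> topspace Y - Y closure_of (\<delta> ?N)"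
      using regular_openin_subset[OF \<delta>r[OF U]] by blast
    moreover have "e ` preimage_map X s U \<subseteq> \<delta> U"
      using up[OF U] by (auto simp: preimage_map_def)
    ultimately have "Y closure_of (e ` preimage_map X s U) \<subseteq>
        Y closure_of (topspace Y - Y closure_of (\<delta> ?N))"
      by (meson closure_of_mono order_trans)
    also have "\<dots> \<subseteq> \<delta> V"
      using D.M3[of U V] U V UV by (simp add: regular_open_complement \<delta>r[OF N])
    finally show ?thesis .
  qed
  obtain k where k: "homeomorphic_maps X (subtopology Y (e ` topspace X)) e k"
    using f(4) unfolding embedding_map_def homeomorphic_map_maps by blast
  have ke: "k (e x) = x" if "x \<in> topspace X" for x using k that by (simp add: homeomorphic_maps_def)
  have lim: "\<exists>z. limitin Z (s \<circ> k) z (atin_within Y y (e ` topspace X))" if y: "y \<in> topspace Y" for y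
  proof -
    \<comment> \<open>The common points of these sets are the cluster points of \<open>s x\<close>
      as \<open>e x\<close> approaches \<open>y\<close>. Finite intersections are nonempty because
      every neighbourhood of \<open>y\<close> contains some \<open>e x\<close>.\<close>
    let ?\<U> = "{Z closure_of (s ` preimage_map X e N) | N. openin Y N \<and> y \<in> N}"
    have fip: "\<Inter>\<F> \<noteq> {}" if "finite \<F>" "\<F> \<subseteq> ?\<U>" for \<F>
    proof -
      have "\<exists>N. openin Y N \<and> y \<in> N \<and> Z closure_of (s ` preimage_map X e N) \<subseteq> \<Inter>\<F>"
        using that
      proof (induction \<F>)
        case empty
        then show ?case using y by blast
      next
        case (insert F \<F>)
        then obtain N M where N: "openin Y N" "y \<in> N" "Z closure_of (s ` preimage_map X e N) \<subseteq> \<Inter>\<F>"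
          and M: "openin Y M" "y \<in> M" "F = Z closure_of (s ` preimage_map X e M)"
          by auto
        have "Z closure_of (s ` preimage_map X e (N \<inter> M)) \<subseteq> Z closure_of (s ` preimage_map X e N)"
          "Z closure_of (s ` preimage_map X e (N \<inter> M)) \<subseteq> Z closure_of (s ` preimage_map X e M)"
          by (rule closure_of_mono; auto simp: preimage_map_def)+
        with N M show ?case by (intro exI[of _ "N \<inter> M"]) auto
      qed
      then obtain N where N: "openin Y N" "y \<in> N" "Z closure_of (s ` preimage_map X e N) \<subseteq> \<Inter>\<F>"
        by blast
      then have "e ` topspace X \<inter> N \<noteq> {}" using f(5) dense_intersects_open by (metis empty_iff)
      then obtain x where "x \<in> topspace X" "e x \<in> N" by auto
      moreover have "s ` preimage_map X e N \<subseteq> Z closure_of (s ` preimage_map X e N)"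
        using embedding_map_image[OF g(4)] by (intro closure_of_subset) (auto simp: preimage_map_def)
      ultimately show ?thesis using N(3) by (auto simp: preimage_map_def)
    qed
    have "\<forall>K\<in>?\<U>. closedin Z K" by auto
    then have "\<Inter>?\<U> \<noteq> {}"
      using g(1) fip unfolding compact_space_fip by blast
    then obtain z where z: "z \<in> \<Inter>?\<U>" by blast
    have zc: "z \<in> Z closure_of (s ` preimage_map X e N)" if "openin Y N" "y \<in> N" for N
      using z that by blast
    have zZ: "z \<in> topspace Z"
      using zc[OF openin_topspace y] closure_of_subset_topspace by (metis subsetD)
    have near: "\<exists>N. openin Y N \<and> y \<in> N \<and> preimage_map X e N \<subseteq> preimage_map X s O'"
      if O': "openin Z O'" "z \<in> O'" for O'
    proof -
      \<comment> \<open>Three nested neighbourhoods are used: \<open>z\<close> in \<open>U\<close>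
        forces \<open>y\<close> into \<open>\<delta> V\<close> by \<open>key\<close>, and
        \<open>down\<close> puts the trace of \<open>\<delta> V\<close> into that of
        \<open>W\<close>.\<close>
      obtain W where W: "regular_openin Z W" "z \<in> W" "Z closure_of W \<subseteq> O'"
        using regular_open_neighbourhood[OF g(3) O'] by blast
      obtain V where V: "regular_openin Z V" "z \<in> V" "Z closure_of V \<subseteq> W"
        using regular_open_neighbourhood[OF g(3) regular_openin_openin[OF W(1)] W(2)] by blast
      obtain U where U: "regular_openin Z U" "z \<in> U" "Z closure_of U \<subseteq> V"
        using regular_open_neighbourhood[OF g(3) regular_openin_openin[OF V(1)] V(2)] by blast
      \<comment> \<open>The roles of \<open>y\<close> and \<open>z\<close> are exchanged: as
        \<open>z\<close> is a cluster point, each neighbourhood of \<open>y\<close> contains some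
        \<open>e x\<close> with \<open>s x\<close> in \<open>U\<close>.\<close>
      have "y \<in> Y closure_of (e ` preimage_map X s U)"
        unfolding in_closure_of
      proof (intro conjI allI impI y)
        fix T assume T: "y \<in> T \<and> openin Y T"
        then obtain x where "x \<in> preimage_map X e T" "s x \<in> U"
          using zc[of T] U(2) regular_openin_openin[OF U(1)] by (auto simp: in_closure_of)
        then show "\<exists>w. w \<in> e ` preimage_map X s U \<and> w \<in> T" by (auto simp: preimage_map_def)
      qed
      then have "y \<in> \<delta> V" using key[OF U(1) V(1) U(3)] by blast
      moreover have "preimage_map X e (\<delta> V) \<subseteq> preimage_map X s O'"
        using down[OF V(1) W(1) V(3)] W(3) regular_openin_subset_closure[OF W(1)]
        by (auto simp: preimage_map_def)
      ultimately show ?thesis using regular_openin_openin[OF \<delta>r[OF V(1)]] by blast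
    qed
    have "\<exists>N. openin Y N \<and> y \<in> N \<and> (\<forall>w\<in>N. w \<in> e ` topspace X \<and> w \<noteq> y \<longrightarrow> (s \<circ> k) w \<in> O')"
      if O': "openin Z O'" "z \<in> O'" for O'
    proof -
      obtain N where N: "openin Y N" "y \<in> N" "preimage_map X e N \<subseteq> preimage_map X s O'"
        using near[OF O'] by blast
      have "(s \<circ> k) (e x) \<in> O'" if "x \<in> topspace X" "e x \<in> N" for x
        using N(3) that by (auto simp: preimage_map_def ke)
      with N show ?thesis by blast
    qed
    then have "limitin Z (s \<circ> k) z (atin_within Y y (e ` topspace X))"
      unfolding limitin_def eventually_atin_within using zZ by blast
    then show ?thesis by blast
  qed
  have cont: "continuous_map (subtopology Y (e ` topspace X)) Z (s \<circ> k)"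
    using k g(6) continuous_map_compose unfolding homeomorphic_maps_def by blast
  have sub: "topspace Y \<subseteq> Y closure_of (e ` topspace X)" using f(5) by simp
  obtain F where F: "continuous_map (subtopology Y (topspace Y)) Z F"
    "\<And>y. y \<in> e ` topspace X \<Longrightarrow> F y = (s \<circ> k) y"
    using continuous_map_extension_pointwise_alt[OF g(3) embedding_map_image[OF f(4)] sub cont lim]
    by blast
  then show ?thesis
    unfolding compactification_le_def by (intro exI[of _ F]) (auto simp: ke)
qed


section \<open>Equivalence and isomorphism\<close>

text \<open>The comparison maps compose to maps fixing the dense image of \<open>X\<close>, hence to
  identities because the spaces are Hausdorff. They are paired with the identity of
  \<open>X\<close>.\<close>

lemma compactification_equiv_imp_isomorphic:
  assumes c: "compactification X Y e" and cs: "compactification X Z s"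
    and eq: "compactification_equiv X Y e Z s"
  shows "comp_isomorphic X Y e X Z s"
proof -
  note fc = compactification_facts[OF c] and gc = compactification_facts[OF cs]
  obtain f g where f: "continuous_map Z Y f" "\<And>x. x \<in> topspace X \<Longrightarrow> f (s x) = e x"
    and g: "continuous_map Y Z g" "\<And>x. x \<in> topspace X \<Longrightarrow> g (e x) = s x"
    using eq unfolding compactification_equiv_def compactification_le_def by metis
  have "(f \<circ> g) y = id y" if "y \<in> topspace Y" for y
    by (rule forall_in_closure_of_eq[OF _ fc(2) continuous_map_compose[OF g(1) f(1)] continuous_map_id,
          of _ "e ` topspace X"])
      (use that fc(5) f(2) g(2) in auto)
  moreover have "(g \<circ> f) z = id z" if "z \<in> topspace Z" for z
    by (rule forall_in_closure_of_eq[OF _ gc(2) continuous_map_compose[OF f(1) g(1)] continuous_map_id,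
          of _ "s ` topspace X"])
      (use that gc(5) f(2) g(2) in auto)
  ultimately show ?thesis
    unfolding comp_isomorphic_def using f g
    by (intro exI[of _ "(id, g)"] exI[of _ "(id, f)"])
      (auto simp: comp_morphism_def comp_is_identity_def comp_compose_def)
qed

text \<open>An isomorphism may move the points of \<open>X\<close> by a homeomorphism \<open>f\<close>. This is undone by a map
  of the Stone--Cech compactification into itself, since precomposing \<open>s\<close> with the inverse of \<open>f\<close>
  gives another compactification of \<open>X\<close>.\<close>

lemma isomorphic_stone_cech_imp_equiv:
  assumes c: "compactification X Y e" and s: "stone_cech X Z s"
    and iso: "comp_isomorphic X Y e X Z s"
  shows "compactification_equiv X Y e Z s"
proof -
  have cs: "compactification X Z s" using s by (simp add: stone_cech_def)
  note gc = compactification_facts[OF cs]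
  obtain f g f' where f: "continuous_map X X f" "continuous_map X X f'"
    "\<And>x. x \<in> topspace X \<Longrightarrow> f' (f x) = x" "\<And>x. x \<in> topspace X \<Longrightarrow> f (f' x) = x"
    and g: "continuous_map Y Z g" "\<And>x. x \<in> topspace X \<Longrightarrow> g (e x) = s (f x)"
    using iso unfolding comp_isomorphic_def comp_morphism_def comp_is_identity_def comp_compose_def
    by auto
  have "homeomorphic_maps X X f' f" using f by (simp add: homeomorphic_maps_def)
  then have hom: "homeomorphic_map X X f'" by (auto simp: homeomorphic_map_maps)
  then have img: "f' ` topspace X = topspace X" by (rule homeomorphic_imp_surjective_map)
  have "embedding_map X Z (s \<circ> f')"
    by (rule embedding_map_compose[OF _ gc(4)]) (simp add: embedding_map_def img hom)
  then have "compactification X Z (s \<circ> f')"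
    using cs unfolding compactification_def image_comp[symmetric] img by blast
  from stone_cech_largest[OF s this] obtain k where
    k: "continuous_map Z Z k" "\<And>x. x \<in> topspace X \<Longrightarrow> k (s x) = s (f' x)"
    unfolding compactification_le_def by auto
  have "\<forall>x\<in>topspace X. (k \<circ> g) (e x) = s x"
    using g(2) k(2) f(3) continuous_map_image_subset_topspace[OF f(1)] by (simp add: image_subset_iff)
  then have "compactification_le X Z s Y e"
    unfolding compactification_le_def using continuous_map_compose[OF g(1) k(1)] by blast
  then show ?thesis
    using stone_cech_largest[OF s c] by (simp add: compactification_equiv_def)
qed

theorem theorem6p4:
  fixes X :: "'x topology" and Y :: "'y topology" and \<beta>X :: "'z topology"
    and e :: "'x \<Rightarrow> 'y" and s :: "'x \<Rightarrow> 'z"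
  assumes "completely_regular_space X" and "Hausdorff_space X"
    and "compactification X Y e"
    and "stone_cech X \<beta>X s"
  shows "(maximal_extension (regular_open_algebra Y) (powerset_algebra X) (preimage_map X e)
            \<longleftrightarrow> comp_isomorphic X Y e X \<beta>X s)
       \<and> (comp_isomorphic X Y e X \<beta>X s \<longleftrightarrow> compactification_equiv X Y e \<beta>X s)"
proof -
  let ?max = "maximal_extension (regular_open_algebra Y) (powerset_algebra X) (preimage_map X e)"
  have cs: "compactification X \<beta>X s" using assms(4) by (simp add: stone_cech_def)
  have "compactification_le X \<beta>X s Y e" if max: ?max
  proof -
    \<comment> \<open>Maximality is tested against the extension of \<open>s\<close>. Its points may
      have another type than those of \<open>Y\<close>, hence
      \<open>maximal_extension_universal\<close>.\<close>
    obtain \<delta> where "de_vries_morphism (regular_open_algebra \<beta>X) (regular_open_algebra Y) \<delta>"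
      "\<forall>V\<in>carrier (regular_open_algebra \<beta>X). dv_compose (regular_open_algebra \<beta>X)
         (powerset_algebra X) (preimage_map X e) \<delta> V = preimage_map X s V"
      using maximal_extension_universal[OF max de_vries_extension_compactification[OF cs]
          compatible_compactifications[OF assms(3) cs]] by blast
    then show ?thesis by (intro compactification_le_if_morphism[OF assms(3) cs]) auto
  qed
  then have "?max \<longleftrightarrow> compactification_equiv X Y e \<beta>X s"
    using maximal_extension_if_equiv[OF assms(3,4)] stone_cech_largest[OF assms(4,3)]
    by (auto simp: compactification_equiv_def)
  moreover have "comp_isomorphic X Y e X \<beta>X s \<longleftrightarrow> compactification_equiv X Y e \<beta>X s"
    using compactification_equiv_imp_isomorphic[OF assms(3) cs]
      isomorphic_stone_cech_imp_equiv[OF assms(3,4)] by blast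
  ultimately show ?thesis by blast
qed

end
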